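(* Let $X$ be a real Banach lattice, let $E\subset X$ be a closed subspace, and let $(e_n)_{n\in\mathbb{N}}$ be a semi-normalized, unconditional, absolutely quasi-greedy basis of $E$. Then $(\lambda_n e_n)$ is absolutely quasi-greedy for all real sequences $(\lambda_n)$ with $0<\inf_{n\in\mathbb{N}}|\lambda_n|\leq\sup_{n\in\mathbb{N}}|\lambda_n|<\infty$.
   Context: All Banach spaces are over $\mathbb{R}$; $E$ carries the norm of $X$. "Basis" means Schauder basis; semi-normalized means $0<\inf_n\|e_n\|\le\sup_n\|e_n\|<\infty$; $e_n^*$ denotes the biorthogonal (coefficient) functionals and $\mathrm{supp}(x)=\{n: e_n^*(x)\ne 0\}$. The basis is unconditional if every permutation of it is a basic sequence. A greedy ordering of $x\in E$ is an injective map $\pi:\mathbb{N}\to\mathbb{N}$ with $\mathrm{supp}(x)\subset\pi(\mathbb{N})$ such that $(|e^*_{\pi(n)}(x)|)_n$ is non-increasing. For such $\pi$ and $m\in\mathbb{N}$, $G_{\pi,m}(x)=\sum_{n=1}^m e^*_{\pi(n)}(x)e_{\pi(n)}$ and $G_{\pi,m}^{\vee}(x)=\bigvee_{n=1}^m|G_{\pi,n}(x)|$. The basis $(e_n)$ of $E\subset X$ is absolutely quasi-greedy if for every $x\in E$ there exists $u\in X$ such that $G_{\pi,m}^{\vee}(x)\leq u$ for all greedy orderings $\pi$ of $x$ and all $m\in\mathbb{N}$. For a scaled basis $(\lambda_n e_n)$ the same definitions are used with its own biorthogonal functionals $\lambda_n^{-1}e_n^*$. *)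

theory Defs
  imports "HOL-Analysis.Analysis" "HOL-Library.Lattice_Algebras"
begin

text \<open>
  In a Banach lattice the modulus is \<open>\<bar>x\<bar> = sup x (- x)\<close>; this is the axiom \<open>abs_lattice\<close> of
  the parent class \<^class>\<open>lattice_ab_group_add_abs\<close>.
\<close>

class banach_lattice = banach + ordered_real_vector + lattice_ab_group_add_abs +
  assumes norm_mono_abs: "\<bar>x\<bar> \<le> \<bar>y\<bar> \<Longrightarrow> norm x \<le> norm y"

definition schauder_basis_of :: "'a::real_normed_vector set \<Rightarrow> (nat \<Rightarrow> 'a) \<Rightarrow> bool" where
  "schauder_basis_of E e \<longleftrightarrow>
     range e \<subseteq> E \<and> (\<forall>x\<in>E. \<exists>!a :: nat \<Rightarrow> real. (\<lambda>n. a n *\<^sub>R e n) sums x)"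

definition basic_sequence :: "(nat \<Rightarrow> 'a::real_normed_vector) \<Rightarrow> bool" where
  "basic_sequence e \<longleftrightarrow> schauder_basis_of (closure (span (range e))) e"

definition unconditional :: "(nat \<Rightarrow> 'a::real_normed_vector) \<Rightarrow> bool" where
  "unconditional e \<longleftrightarrow> (\<forall>\<sigma> :: nat \<Rightarrow> nat. bij \<sigma> \<longrightarrow> basic_sequence (e \<circ> \<sigma>))"

definition semi_normalized :: "(nat \<Rightarrow> 'a::real_normed_vector) \<Rightarrow> bool" where
  "semi_normalized e \<longleftrightarrow> 0 < (INF n. norm (e n)) \<and> bdd_above (range (\<lambda>n. norm (e n)))"

text \<open>
  \<open>coeff_fun e n x\<close> is $e_n^*(x)$. It is meaningful only if \<open>e\<close> is a Schauder basis of a space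
  containing \<open>x\<close>.
\<close>

definition coeff_fun :: "(nat \<Rightarrow> 'a::real_normed_vector) \<Rightarrow> nat \<Rightarrow> 'a \<Rightarrow> real" where
  "coeff_fun e n x = (THE a :: nat \<Rightarrow> real. (\<lambda>k. a k *\<^sub>R e k) sums x) n"

definition supp :: "(nat \<Rightarrow> 'a::real_normed_vector) \<Rightarrow> 'a \<Rightarrow> nat set" where
  "supp e x = {n. coeff_fun e n x \<noteq> 0}"

definition greedy_ordering ::
    "(nat \<Rightarrow> 'a::real_normed_vector) \<Rightarrow> 'a \<Rightarrow> (nat \<Rightarrow> nat) \<Rightarrow> bool" where
  "greedy_ordering e x \<pi> \<longleftrightarrow>
     inj \<pi> \<and> supp e x \<subseteq> range \<pi> \<and> decseq (\<lambda>n. \<bar>coeff_fun e (\<pi> n) x\<bar>)"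

text \<open>
  Orderings are indexed from \<open>0\<close>, so the \<open>m\<close>-th greedy sum uses \<open>\<pi> 0, \<dots>, \<pi> (m - 1)\<close>.
\<close>

definition greedy_sum ::
    "(nat \<Rightarrow> 'a::real_normed_vector) \<Rightarrow> (nat \<Rightarrow> nat) \<Rightarrow> nat \<Rightarrow> 'a \<Rightarrow> 'a" where
  "greedy_sum e \<pi> m x = (\<Sum>n<m. coeff_fun e (\<pi> n) x *\<^sub>R e (\<pi> n))"

text \<open>
  The lattice maximum of $|G_{\pi,1}(x)|, \dots, |G_{\pi,m}(x)|$, meaningful for \<open>m \<ge> 1\<close>
  (\<^const>\<open>Sup_fin\<close> is unspecified on the empty set).
\<close>

definition greedy_max ::
    "(nat \<Rightarrow> 'a::banach_lattice) \<Rightarrow> (nat \<Rightarrow> nat) \<Rightarrow> nat \<Rightarrow> 'a \<Rightarrow> 'a" where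
  "greedy_max e \<pi> m x = Sup_fin ((\<lambda>n. \<bar>greedy_sum e \<pi> n x\<bar>) ` {1..m})"

definition absolutely_quasi_greedy :: "'a::banach_lattice set \<Rightarrow> (nat \<Rightarrow> 'a) \<Rightarrow> bool" where
  "absolutely_quasi_greedy E e \<longleftrightarrow>
     schauder_basis_of E e \<and>
     (\<forall>x\<in>E. \<exists>u. \<forall>\<pi> m. greedy_ordering e x \<pi> \<longrightarrow> m \<ge> 1 \<longrightarrow> greedy_max e \<pi> m x \<le> u)"

end

theory Submission
  imports Defs
begin

text \<open>
  Let \<open>x\<close> have coefficients \<open>a n\<close> with respect to \<open>e\<close>, hence \<open>b n = a n / l n\<close> with respect to
  \<open>l n *\<^sub>R e n\<close>. One has to bound \<open>\<Sum>n\<in>A. l n * b n *\<^sub>R e n\<close> for all finite sets \<open>A\<close> of largest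
  coefficients of \<open>b\<close>. The lattice maximum of the moduli of these sums, restricted to a finite block
  \<open>D\<close> of indices, has a norm that is convex in the multiplier \<open>l\<close>, so \<open>l n\<close> may be replaced by
  signs \<open>s n\<close>. For signs, the sets of largest coefficients of \<open>s n * b n\<close> are those of \<open>b\<close>, so that a
  gliding hump argument applied to the absolutely quasi-greedy basis \<open>e\<close> shows these norms to be
  small for all blocks \<open>D\<close> far out. An upper bound is then obtained by summing over blocks.
  Unconditionality enters through the smallness of all sums of \<open>\<mu> n * a n *\<^sub>R e n\<close> over far-out
  finite sets with \<open>\<bar>\<mu> n\<bar> \<le> 1\<close>.
\<close>

subsection \<open>Banach lattices\<close>

lemma norm_mono_nonneg: "0 \<le> x \<Longrightarrow> x \<le> y \<Longrightarrow> norm x \<le> norm (y::'a::banach_lattice)"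
  by (rule norm_mono_abs) (auto simp: abs_of_nonneg)

lemma abs_scaleR_le:
  fixes x :: "'a::banach_lattice"
  assumes "0 \<le> t"
  shows "\<bar>t *\<^sub>R x\<bar> \<le> t *\<^sub>R \<bar>x\<bar>"
proof (rule abs_leI)
  show "t *\<^sub>R x \<le> t *\<^sub>R \<bar>x\<bar>"
    using assms by (intro scaleR_left_mono) (auto simp: abs_ge_self)
  have "t *\<^sub>R (- x) \<le> t *\<^sub>R \<bar>x\<bar>"
    using assms by (intro scaleR_left_mono) (auto simp: abs_ge_minus_self)
  then show "- (t *\<^sub>R x) \<le> t *\<^sub>R \<bar>x\<bar>" by simp
qed

text \<open>Once \<open>f n\<close> is positive, \<open>- x \<le> \<bar>f n - x\<bar>\<close>, so
  the modulus of the negative part of \<open>x\<close> lies below \<open>\<bar>f n - x\<bar>\<close>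
  and its norm below a null sequence.\<close>

lemma tendsto_nonneg_lattice:
  fixes x :: "'a::banach_lattice"
  assumes "f \<longlonglongrightarrow> x" and "\<forall>\<^sub>F n in sequentially. 0 \<le> f n"
  shows "0 \<le> x"
proof -
  have le: "norm (nprt x) \<le> norm (f n - x)" if "0 \<le> f n" for n
  proof (rule norm_mono_abs)
    have "- x \<le> f n - x" using that by simp
    also have "\<dots> \<le> \<bar>f n - x\<bar>" by (rule abs_ge_self)
    finally have "- nprt x \<le> \<bar>f n - x\<bar>"
      by (simp add: nprt_def neg_inf_eq_sup)
    then show "\<bar>nprt x\<bar> \<le> \<bar>f n - x\<bar>"
      by (simp add: abs_of_nonpos)
  qed
  have "(\<lambda>n. norm (f n - x)) \<longlonglongrightarrow> 0"
    using assms(1) by (simp add: LIM_zero tendsto_norm_zero)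
  then have "norm (nprt x) \<le> 0"
    by (rule tendsto_lowerbound) (use assms(2) le in \<open>auto elim: eventually_mono\<close>)
  then show ?thesis by (simp add: zero_le_iff_zero_nprt)
qed

text \<open>The remainder of a positive series is a limit of positive elements, and the positive
  cone is closed.\<close>

lemma sum_le_suminf_lattice:
  fixes v :: "nat \<Rightarrow> 'a::banach_lattice"
  assumes "summable v" and "\<And>k. 0 \<le> v k"
  shows "(\<Sum>k<K. v k) \<le> suminf v"
proof -
  have "(\<lambda>n. (\<Sum>k<n. v k) - (\<Sum>k<K. v k)) \<longlonglongrightarrow> suminf v - (\<Sum>k<K. v k)"
    by (intro tendsto_intros summable_LIMSEQ assms)
  moreover have "\<forall>\<^sub>F n in sequentially. 0 \<le> (\<Sum>k<n. v k) - (\<Sum>k<K. v k)"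
    using eventually_ge_at_top[of K]
    by eventually_elim (auto intro!: sum_mono2 assms)
  ultimately have "0 \<le> suminf v - (\<Sum>k<K. v k)"
    by (rule tendsto_nonneg_lattice)
  then show ?thesis by simp
qed

subsection \<open>Greedy sets\<close>

text \<open>Ties may be cut anywhere, since the inequality is not strict. The ground set
  \<open>D\<close> is a parameter because a greedy set of \<open>UNIV\<close> meets each block in a
  greedy set of that block, which allows estimates block by block.\<close>

definition greedy_sets :: "(nat \<Rightarrow> real) \<Rightarrow> nat set \<Rightarrow> nat set set" where
  "greedy_sets b D = {S. S \<subseteq> D \<and> (\<forall>i\<in>S. \<forall>j\<in>D - S. \<bar>b j\<bar> \<le> \<bar>b i\<bar>)}"

text \<open>The sequence \<open>b\<close> selects the sets and \<open>\<mu>\<close> supplies the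
  weights. Keeping them apart makes the maximum sublinear in \<open>\<mu>\<close>, the family of
  sets being fixed.\<close>

definition max_greedy ::
    "(nat \<Rightarrow> real) \<Rightarrow> (nat \<Rightarrow> 'a::banach_lattice) \<Rightarrow> nat set \<Rightarrow> (nat \<Rightarrow> real) \<Rightarrow> 'a" where
  "max_greedy b e D \<mu> = Sup_fin ((\<lambda>S. \<bar>\<Sum>n\<in>S. \<mu> n *\<^sub>R e n\<bar>) ` greedy_sets b D)"

lemma greedy_sets_Int: "S \<in> greedy_sets b UNIV \<Longrightarrow> S \<inter> D \<in> greedy_sets b D"
  by (auto simp: greedy_sets_def)

lemma greedy_sets_UNIV_I:
  "(\<And>i j. i \<in> S \<Longrightarrow> j \<notin> S \<Longrightarrow> \<bar>b j\<bar> \<le> \<bar>b i\<bar>) \<Longrightarrow> S \<in> greedy_sets b UNIV"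
  by (simp add: greedy_sets_def)

lemma empty_in_greedy_sets [simp]: "{} \<in> greedy_sets b D"
  by (simp add: greedy_sets_def)

lemma finite_greedy_sets [simp]: "finite D \<Longrightarrow> finite (greedy_sets b D)"
  by (rule finite_subset[of _ "Pow D"]) (auto simp: greedy_sets_def)

lemma greedy_sum_le_max_greedy:
  assumes "finite D" and "S \<in> greedy_sets b D"
  shows "\<bar>\<Sum>n\<in>S. \<mu> n *\<^sub>R e n\<bar> \<le> max_greedy b e D \<mu>"
  unfolding max_greedy_def using assms by (intro Sup_fin.coboundedI) auto

lemma max_greedy_nonneg:
  assumes "finite D"
  shows "0 \<le> max_greedy b e D \<mu>"
  using greedy_sum_le_max_greedy[OF assms empty_in_greedy_sets, of \<mu> e b] by simp

lemma max_greedy_le: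
  assumes "finite D" and "\<And>S. S \<in> greedy_sets b D \<Longrightarrow> \<bar>\<Sum>n\<in>S. \<mu> n *\<^sub>R e n\<bar> \<le> u"
  shows "max_greedy b e D \<mu> \<le> u"
proof -
  have "greedy_sets b D \<noteq> {}" using empty_in_greedy_sets by blast
  then show ?thesis
    unfolding max_greedy_def using assms by (intro Sup_fin.boundedI) auto
qed

lemma max_greedy_comb:
  assumes "finite D" "0 \<le> s" "0 \<le> t"
  shows "max_greedy b e D (\<lambda>n. s * \<mu> n + t * \<nu> n)
    \<le> s *\<^sub>R max_greedy b e D \<mu> + t *\<^sub>R max_greedy b e D \<nu>"
proof (rule max_greedy_le[OF assms(1)])
  fix S assume S: "S \<in> greedy_sets b D"
  let ?s = "\<lambda>\<mu>. \<Sum>n\<in>S. \<mu> n *\<^sub>R e n"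
  have "\<bar>?s (\<lambda>n. s * \<mu> n + t * \<nu> n)\<bar> = \<bar>s *\<^sub>R ?s \<mu> + t *\<^sub>R ?s \<nu>\<bar>"
    by (simp add: scaleR_sum_right sum.distrib algebra_simps)
  also have "\<dots> \<le> \<bar>s *\<^sub>R ?s \<mu>\<bar> + \<bar>t *\<^sub>R ?s \<nu>\<bar>" by (rule abs_triangle_ineq)
  also have "\<dots> \<le> s *\<^sub>R \<bar>?s \<mu>\<bar> + t *\<^sub>R \<bar>?s \<nu>\<bar>"
    by (intro add_mono abs_scaleR_le assms)
  also have "\<dots> \<le> s *\<^sub>R max_greedy b e D \<mu> + t *\<^sub>R max_greedy b e D \<nu>"
    by (intro add_mono scaleR_left_mono greedy_sum_le_max_greedy assms S)
  finally show "\<bar>?s (\<lambda>n. s * \<mu> n + t * \<nu> n)\<bar> \<le> \<dots>" .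
qed

lemma norm_max_greedy_comb:
  assumes "finite D" "0 \<le> s" "0 \<le> t"
  shows "norm (max_greedy b e D (\<lambda>n. s * \<mu> n + t * \<nu> n))
    \<le> s * norm (max_greedy b e D \<mu>) + t * norm (max_greedy b e D \<nu>)"
proof -
  have "norm (max_greedy b e D (\<lambda>n. s * \<mu> n + t * \<nu> n))
      \<le> norm (s *\<^sub>R max_greedy b e D \<mu> + t *\<^sub>R max_greedy b e D \<nu>)"
    by (intro norm_mono_nonneg max_greedy_comb max_greedy_nonneg assms)
  also have "\<dots> \<le> s * norm (max_greedy b e D \<mu>) + t * norm (max_greedy b e D \<nu>)"
    using norm_triangle_ineq[of "s *\<^sub>R max_greedy b e D \<mu>" "t *\<^sub>R max_greedy b e D \<nu>"] assms by simp
  finally show ?thesis .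
qed

section \<open>Passing between greedy orderings and greedy sets\<close>

lemma finite_large_coefficients:
  fixes c :: "nat \<Rightarrow> real"
  assumes "c \<longlonglongrightarrow> 0" and "0 < \<epsilon>"
  shows "finite {n. \<epsilon> \<le> \<bar>c n\<bar>}"
proof -
  have "\<forall>\<^sub>F n in sequentially. \<bar>c n\<bar> < \<epsilon>"
    using tendstoD[OF assms] by (simp add: dist_real_def)
  then obtain N where "\<And>n. n \<ge> N \<Longrightarrow> \<bar>c n\<bar> < \<epsilon>"
    by (auto simp: eventually_sequentially)
  then have "{n. \<epsilon> \<le> \<bar>c n\<bar>} \<subseteq> {..<N}"
    by (auto simp: not_less[symmetric] intro: leI)
  then show ?thesis by (rule finite_subset) simp
qed

text \<open>Only finitely many entries of a null sequence are at least as large as a given nonzero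
  one, so the supremum over \<open>T\<close> is attained even if \<open>T\<close> is
  infinite.\<close>

lemma largest_coefficient_exists:
  fixes c :: "nat \<Rightarrow> real"
  assumes "c \<longlonglongrightarrow> 0" and "T \<noteq> {}"
  shows "\<exists>j\<in>T. \<forall>i\<in>T. \<bar>c i\<bar> \<le> \<bar>c j\<bar>"
proof (cases "\<forall>i\<in>T. c i = 0")
  case True
  then show ?thesis using assms(2) by auto
next
  case False
  then obtain i0 where i0: "i0 \<in> T" "c i0 \<noteq> 0" by auto
  let ?L = "{i\<in>T. \<bar>c i0\<bar> \<le> \<bar>c i\<bar>}"
  have "finite ?L"
    by (rule finite_subset[OF _ finite_large_coefficients[OF assms(1), of "\<bar>c i0\<bar>"]]) (use i0 in auto)
  moreover have "i0 \<in> ?L" using i0 by simp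
  ultimately have "Max ((\<lambda>i. \<bar>c i\<bar>) ` ?L) \<in> (\<lambda>i. \<bar>c i\<bar>) ` ?L"
    by (intro Max_in) auto
  then obtain j where "j \<in> ?L" "Max ((\<lambda>i. \<bar>c i\<bar>) ` ?L) = \<bar>c j\<bar>"
    by blast
  then have j: "j \<in> ?L" "\<And>i. i \<in> ?L \<Longrightarrow> \<bar>c i\<bar> \<le> \<bar>c j\<bar>"
    using Max_ge[of "(\<lambda>i. \<bar>c i\<bar>) ` ?L"] \<open>finite ?L\<close> by auto
  have "\<bar>c i\<bar> \<le> \<bar>c j\<bar>" if "i \<in> T" for i
    using that j by (cases "\<bar>c i0\<bar> \<le> \<bar>c i\<bar>") auto
  then show ?thesis using j(1) by auto
qed

text \<open>Always choose a largest remaining coefficient, exhausting \<open>A\<close> first. As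
  \<open>A\<close> is greedy, a largest coefficient in the rest of \<open>A\<close> is a largest one
  among all remaining indices.\<close>

lemma greedy_ordering_through_set:
  fixes c :: "nat \<Rightarrow> real"
  assumes c: "c \<longlonglongrightarrow> 0" and A: "finite A" "A \<in> greedy_sets c UNIV"
  shows "\<exists>\<pi>. inj \<pi> \<and> {n. c n \<noteq> 0} \<subseteq> range \<pi> \<and> decseq (\<lambda>n. \<bar>c (\<pi> n)\<bar>) \<and> \<pi> ` {..<card A} = A"
proof -
  \<comment> \<open>\<open>P\<close> keeps the set chosen so far comparable with \<open>A\<close>;
    once it has \<open>card A\<close> elements it must therefore equal \<open>A\<close>.\<close>
  define P where "P S \<longleftrightarrow> finite S \<and> (S \<subseteq> A \<or> A \<subseteq> S)" for S
  define R where "R S j \<longleftrightarrow> j \<notin> S \<and> (\<forall>i. i \<notin> S \<longrightarrow> \<bar>c i\<bar> \<le> \<bar>c j\<bar>) \<and> P (insert j S)" for S j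
  have step: "\<exists>j. R S j" if "P S" for S
  proof (cases "A \<subseteq> S")
    case True
    have "infinite (- S)" using that by (simp add: P_def Compl_eq_Diff_UNIV)
    then have "- S \<noteq> {}" by force
    from largest_coefficient_exists[OF c this] obtain j
      where "j \<in> - S" "\<forall>i\<in>-S. \<bar>c i\<bar> \<le> \<bar>c j\<bar>" by blast
    then show ?thesis using True that by (auto simp: R_def P_def)
  next
    case False
    then have SA: "S \<subseteq> A" using that by (auto simp: P_def)
    from False have "A - S \<noteq> {}" by auto
    from largest_coefficient_exists[OF c this] obtain j
      where j: "j \<in> A - S" "\<forall>i\<in>A-S. \<bar>c i\<bar> \<le> \<bar>c j\<bar>" by blast
    have "\<bar>c i\<bar> \<le> \<bar>c j\<bar>" if "i \<notin> S" for i
      using A(2) j that by (cases "i \<in> A") (auto simp: greedy_sets_def)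
    then show ?thesis using SA that j by (auto simp: R_def P_def)
  qed
  define nxt where "nxt S = (SOME j. R S j)" for S
  have nxt: "R S (nxt S)" if "P S" for S
    unfolding nxt_def using step[OF that] by (rule someI_ex)
  define F where "F = rec_nat {} (\<lambda>_ S. insert (nxt S) S)"
  define \<pi> where "\<pi> n = nxt (F n)" for n
  have F0: "F 0 = {}" and FS: "F (Suc n) = insert (\<pi> n) (F n)" for n
    by (simp_all add: F_def \<pi>_def)
  have PF: "P (F n)" for n
  proof (induction n)
    case (Suc n)
    then show ?case using nxt[of "F n"] by (simp add: FS \<pi>_def R_def)
  qed (simp add: F0 P_def)
  have F_eq: "F n = \<pi> ` {..<n}" for n
    by (induction n) (auto simp: F0 FS lessThan_Suc)
  have fresh: "\<pi> n \<notin> F n" and large: "i \<notin> F n \<Longrightarrow> \<bar>c i\<bar> \<le> \<bar>c (\<pi> n)\<bar>" for n i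
    using nxt[OF PF, of n] by (auto simp: R_def \<pi>_def)
  have "\<pi> m \<noteq> \<pi> n" if "m < n" for m n
    using fresh[of n] that unfolding F_eq by (metis imageI lessThan_iff)
  then have inj: "inj \<pi>"
    by (metis injI linorder_neqE_nat)
  have "\<pi> (Suc n) \<notin> F n" for n using fresh[of "Suc n"] by (simp add: FS)
  then have dec: "decseq (\<lambda>n. \<bar>c (\<pi> n)\<bar>)"
    by (intro decseq_SucI large)
  \<comment> \<open>A nonzero coefficient that is never chosen would be dominated by all the chosen
    ones, which are infinitely many, against the convergence of \<open>c\<close> to 0.\<close>
  have "n \<in> range \<pi>" if "c n \<noteq> 0" for n
  proof (rule ccontr)
    assume "n \<notin> range \<pi>"
    then have "range \<pi> \<subseteq> {i. \<bar>c n\<bar> \<le> \<bar>c i\<bar>}"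
      using large[of n] by (auto simp: F_eq)
    then have "finite (range \<pi>)"
      using finite_large_coefficients[OF c, of "\<bar>c n\<bar>"] that by (simp add: finite_subset)
    then show False using finite_imageD[OF _ inj] by simp
  qed
  moreover have "F (card A) = A"
  proof -
    have "card (F (card A)) = card A"
      unfolding F_eq using inj by (simp add: card_image inj_on_subset)
    then show ?thesis
      using PF[of "card A"] A(1) unfolding P_def by (metis card_subset_eq)
  qed
  ultimately show ?thesis
    using inj dec by (intro exI[of _ \<pi>]) (auto simp: F_eq)
qed

text \<open>An index outside the first \<open>m\<close> choices either is chosen later, hence has no
  larger coefficient, or is never chosen, hence has coefficient zero.\<close>

lemma greedy_ordering_image:
  assumes "greedy_ordering e x \<pi>"
  shows "\<pi> ` {..<m} \<in> greedy_sets (\<lambda>n. coeff_fun e n x) UNIV"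
proof -
  have "\<bar>coeff_fun e j x\<bar> \<le> \<bar>coeff_fun e (\<pi> i) x\<bar>" if "i < m" "j \<notin> \<pi> ` {..<m}" for i j
  proof (cases "j \<in> range \<pi>")
    case True
    then obtain k where k: "j = \<pi> k" by auto
    with that have "i \<le> k" by force
    then show ?thesis
      using assms k by (auto simp: greedy_ordering_def decseq_def)
  next
    case False
    then have "coeff_fun e j x = 0"
      using assms by (auto simp: greedy_ordering_def supp_def)
    then show ?thesis by simp
  qed
  then show ?thesis by (auto simp: greedy_sets_def)
qed

lemma greedy_sum_eq_sum_image:
  assumes "inj \<pi>"
  shows "greedy_sum e \<pi> m x = (\<Sum>n\<in>\<pi> ` {..<m}. coeff_fun e n x *\<^sub>R e n)"
  unfolding greedy_sum_def using inj_on_subset[OF assms, of "{..<m}"] by (simp add: sum.reindex)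

lemma abs_greedy_sum_le_greedy_max:
  assumes "1 \<le> n" "n \<le> m"
  shows "\<bar>greedy_sum e \<pi> n x\<bar> \<le> greedy_max e \<pi> m x"
  unfolding greedy_max_def using assms by (intro Sup_fin.coboundedI) auto

text \<open>Every nonempty finite greedy set is an initial piece of a greedy ordering, so its sum is
  one of those bounded by \<open>greedy_max\<close>. Together with
  \<open>absolutely_quasi_greedyI\<close> this replaces orderings by sets.\<close>

lemma absolutely_quasi_greedy_bound:
  fixes e :: "nat \<Rightarrow> 'a::banach_lattice"
  assumes "absolutely_quasi_greedy E e" "x \<in> E" and lim: "(\<lambda>n. coeff_fun e n x) \<longlonglongrightarrow> 0"
  shows "\<exists>u. \<forall>A\<in>greedy_sets (\<lambda>n. coeff_fun e n x) UNIV.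
    finite A \<longrightarrow> \<bar>\<Sum>n\<in>A. coeff_fun e n x *\<^sub>R e n\<bar> \<le> u"
proof -
  let ?c = "\<lambda>n. coeff_fun e n x"
  from assms obtain u
    where u: "\<And>\<pi> m. greedy_ordering e x \<pi> \<Longrightarrow> 1 \<le> m \<Longrightarrow> greedy_max e \<pi> m x \<le> u"
    unfolding absolutely_quasi_greedy_def by blast
  have *: "\<bar>\<Sum>n\<in>A. ?c n *\<^sub>R e n\<bar> \<le> u"
    if A: "A \<in> greedy_sets ?c UNIV" "finite A" "A \<noteq> {}" for A
  proof -
    from greedy_ordering_through_set[OF lim A(2,1)] obtain \<pi>
      where \<pi>: "inj \<pi>" "{n. ?c n \<noteq> 0} \<subseteq> range \<pi>" "decseq (\<lambda>n. \<bar>?c (\<pi> n)\<bar>)" "\<pi> ` {..<card A} = A"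
      by blast
    then have "greedy_ordering e x \<pi>" by (simp add: greedy_ordering_def supp_def)
    moreover have "1 \<le> card A" using A by (simp add: Suc_le_eq card_gt_0_iff)
    ultimately have "\<bar>greedy_sum e \<pi> (card A) x\<bar> \<le> u"
      using u[of \<pi> "card A"] abs_greedy_sum_le_greedy_max[of "card A" "card A" e \<pi> x]
      by (meson order.refl order.trans)
    then show ?thesis using \<pi>(4) by (simp add: greedy_sum_eq_sum_image[OF \<pi>(1)])
  qed
  \<comment> \<open>The empty set requires \<open>0 \<le> u\<close>, which comes from the greedy
    singleton of a largest coefficient.\<close>
  obtain j where "\<forall>i. \<bar>?c i\<bar> \<le> \<bar>?c j\<bar>"
    using largest_coefficient_exists[OF lim, of UNIV] by auto
  then have "{j} \<in> greedy_sets ?c UNIV" by (simp add: greedy_sets_def)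
  from *[OF this] have "0 \<le> u" by (auto intro: order.trans[OF abs_ge_zero])
  then have "\<bar>\<Sum>n\<in>A. ?c n *\<^sub>R e n\<bar> \<le> u" if "A \<in> greedy_sets ?c UNIV" "finite A" for A
    using *[OF that] by (cases "A = {}") simp_all
  then show ?thesis by blast
qed

lemma absolutely_quasi_greedyI:
  assumes "schauder_basis_of E e"
    and bound: "\<And>x. x \<in> E \<Longrightarrow> \<exists>u. \<forall>A\<in>greedy_sets (\<lambda>n. coeff_fun e n x) UNIV.
        finite A \<longrightarrow> \<bar>\<Sum>n\<in>A. coeff_fun e n x *\<^sub>R e n\<bar> \<le> u"
  shows "absolutely_quasi_greedy E e"
  unfolding absolutely_quasi_greedy_def
proof (intro conjI ballI assms(1))
  fix x assume "x \<in> E"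
  from bound[OF this] obtain u
    where u: "\<And>A. A \<in> greedy_sets (\<lambda>n. coeff_fun e n x) UNIV \<Longrightarrow> finite A \<Longrightarrow>
      \<bar>\<Sum>n\<in>A. coeff_fun e n x *\<^sub>R e n\<bar> \<le> u"
    by blast
  have "greedy_max e \<pi> m x \<le> u" if \<pi>: "greedy_ordering e x \<pi>" and "1 \<le> m" for \<pi> m
  proof -
    have "\<bar>greedy_sum e \<pi> n x\<bar> \<le> u" for n
      using u[OF greedy_ordering_image[OF \<pi>], of n] \<pi>
      by (simp add: greedy_sum_eq_sum_image greedy_ordering_def)
    then show ?thesis
      unfolding greedy_max_def using \<open>1 \<le> m\<close> by (intro Sup_fin.boundedI) auto
  qed
  then show "\<exists>u. \<forall>\<pi> m. greedy_ordering e x \<pi> \<longrightarrow> 1 \<le> m \<longrightarrow> greedy_max e \<pi> m x \<le> u"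
    by blast
qed

subsection \<open>Continuity of the coefficient functionals\<close>

lemma coeff_fun_unique:
  assumes "schauder_basis_of E e" "x \<in> E" "(\<lambda>k. a k *\<^sub>R e k) sums x"
  shows "coeff_fun e n x = a n"
proof -
  have "(THE a. (\<lambda>k. a k *\<^sub>R e k) sums x) = a"
    using assms by (intro the1_equality) (auto simp: schauder_basis_of_def)
  then show ?thesis by (simp add: coeff_fun_def)
qed

lemma coeff_fun_sums:
  assumes "schauder_basis_of E e" "x \<in> E"
  shows "(\<lambda>k. coeff_fun e k x *\<^sub>R e k) sums x"
proof -
  from assms have "\<exists>!a. (\<lambda>k. a k *\<^sub>R e k) sums x" by (auto simp: schauder_basis_of_def)
  then obtain a where "(\<lambda>k. a k *\<^sub>R e k) sums x" by blast
  with coeff_fun_unique[OF assms this] show ?thesis by simp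
qed

lemma coeff_fun_basis:
  assumes "schauder_basis_of E e"
  shows "coeff_fun e n (e k) = (if n = k then 1 else 0)"
proof (rule coeff_fun_unique[OF assms])
  show "e k \<in> E" using assms by (auto simp: schauder_basis_of_def)
  have "(\<lambda>j. if j = k then e j else 0) sums e k" by (rule sums_single)
  moreover have "(\<lambda>j. if j = k then e j else 0) = (\<lambda>j. (if j = k then 1 else 0) *\<^sub>R e j)"
    by auto
  ultimately show "(\<lambda>j. (if j = k then 1 else 0) *\<^sub>R e j) sums e k" by simp
qed

lemma coeff_fun_add:
  assumes "schauder_basis_of E e" "subspace E" "x \<in> E" "y \<in> E"
  shows "coeff_fun e n (x + y) = coeff_fun e n x + coeff_fun e n y"
proof (rule coeff_fun_unique[OF assms(1)])
  show "(\<lambda>k. (coeff_fun e k x + coeff_fun e k y) *\<^sub>R e k) sums (x + y)"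
    using sums_add[OF coeff_fun_sums[OF assms(1,3)] coeff_fun_sums[OF assms(1,4)]]
    by (simp add: scaleR_add_left)
qed (use assms in \<open>simp add: subspace_add\<close>)

lemma coeff_fun_scaleR:
  assumes "schauder_basis_of E e" "subspace E" "x \<in> E"
  shows "coeff_fun e n (t *\<^sub>R x) = t * coeff_fun e n x"
proof (rule coeff_fun_unique[OF assms(1)])
  show "(\<lambda>k. (t * coeff_fun e k x) *\<^sub>R e k) sums (t *\<^sub>R x)"
    using sums_scaleR_right[OF coeff_fun_sums[OF assms(1,3)], of t] by simp
qed (use assms in \<open>simp add: subspace_scale\<close>)

lemma coeff_fun_zero:
  assumes "schauder_basis_of E e" "subspace E"
  shows "coeff_fun e n 0 = 0"
  using coeff_fun_scaleR[OF assms, of 0 n 0] assms(2) by (simp add: subspace_0)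

lemma coeff_fun_diff:
  assumes "schauder_basis_of E e" "subspace E" "x \<in> E" "y \<in> E"
  shows "coeff_fun e n (x - y) = coeff_fun e n x - coeff_fun e n y"
  using coeff_fun_add[OF assms(1,2), of "x - y" y n] assms by (simp add: subspace_diff)

lemma coeff_fun_sum:
  assumes "schauder_basis_of E e" "subspace E" "\<And>i. i \<in> I \<Longrightarrow> f i \<in> E"
  shows "coeff_fun e n (\<Sum>i\<in>I. f i) = (\<Sum>i\<in>I. coeff_fun e n (f i))"
  using assms(3)
proof (induction I rule: infinite_finite_induct)
  case (insert i I)
  then show ?case
    using coeff_fun_add[OF assms(1,2), of "f i" "sum f I" n] assms(2)
    by (simp add: subspace_sum)
qed (simp_all add: coeff_fun_zero[OF assms(1,2)])

lemma basis_nonzero: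
  assumes "schauder_basis_of E e" "subspace E"
  shows "e k \<noteq> 0"
  using coeff_fun_basis[OF assms(1), of k k] coeff_fun_zero[OF assms, of k] by auto

text \<open>
  By Baire's theorem, the vectors with partial sums bounded by some constant are dense in a ball
  of \<open>E\<close>. Successive approximation turns this into the continuity of the coefficient functionals.
\<close>

lemma partial_sums_bounded_dense:
  fixes E :: "'a::banach set"
  assumes "subspace E" "closed E" "schauder_basis_of E e"
  defines "S \<equiv> \<lambda>n x. \<Sum>k<n. coeff_fun e k x *\<^sub>R e k"
  shows "\<exists>r>0. \<exists>M\<ge>0. \<forall>x\<in>E. \<forall>t>0. norm x < r * t \<longrightarrow>
    (\<forall>\<delta>>0. \<exists>y\<in>E. norm (x - y) < \<delta> \<and> (\<forall>n. norm (S n y) \<le> M * t))"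
proof -
  note E = assms(1) and basis = assms(3)
  \<comment> \<open>Continuity of the partial sums is not yet available, so the sets
    \<open>F m\<close> are not known to be closed; Baire's theorem is applied to their closures,
    which cover \<open>E\<close>.\<close>
  define F where "F m = {x\<in>E. \<forall>n. norm (S n x) \<le> real m}" for m :: nat
  let ?X = "top_of_set E"
  have ex: "\<exists>m. x \<in> F m" if "x \<in> E" for x
  proof -
    have "(\<lambda>n. S n x) \<longlonglongrightarrow> x"
      using coeff_fun_sums[OF basis that] by (simp add: sums_def S_def)
    then have "Bseq (\<lambda>n. S n x)" by (intro convergent_imp_Bseq convergentI)
    then obtain K where "\<forall>n. norm (S n x) \<le> K" unfolding Bseq_def by blast
    moreover obtain m where "K \<le> real m" using real_arch_simple by blast
    ultimately have "\<forall>n. norm (S n x) \<le> real m" by (meson order.trans)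
    then show ?thesis using that by (auto simp: F_def)
  qed
  have FE: "closure (F m) \<subseteq> E" for m
    by (rule closure_minimal) (auto simp: F_def assms)
  have UN: "\<Union> (range (\<lambda>m. closure (F m))) = E"
  proof
    show "E \<subseteq> \<Union> (range (\<lambda>m. closure (F m)))"
    proof
      fix x assume "x \<in> E"
      then obtain m where "x \<in> F m" using ex by blast
      then have "x \<in> closure (F m)" by (rule subsetD[OF closure_subset])
      then show "x \<in> \<Union> (range (\<lambda>m. closure (F m)))" by blast
    qed
  qed (rule UN_least[OF FE])
  have "\<exists>m. ?X interior_of closure (F m) \<noteq> {}"
  proof (rule ccontr)
    assume *: "\<not> ?thesis"
    have "?X interior_of \<Union> (range (\<lambda>m. closure (F m))) = {}"
    proof (rule Baire_category_alt)
      show "completely_metrizable_space ?X \<or> locally_compact_space ?X \<and> regular_space ?X"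
        using completely_metrizable_space_closedin[OF completely_metrizable_space_euclidean, of E] assms(2)
        by simp
      fix T assume "T \<in> range (\<lambda>m. closure (F m))"
      then obtain m where "T = closure (F m)" by blast
      then show "closedin ?X T \<and> ?X interior_of T = {}"
        using * FE[of m] by (auto intro: closed_subset)
    qed simp
    moreover have "?X interior_of E = E"
      by (metis interior_of_topspace topspace_euclidean_subtopology)
    ultimately show False using UN subspace_0[OF E] by auto
  qed
  then obtain m x0 where "x0 \<in> ?X interior_of closure (F m)" by blast
  then obtain U where U: "openin ?X U" "x0 \<in> U" "U \<subseteq> closure (F m)"
    by (auto simp: interior_of_def)
  then have "\<exists>r>0. ball x0 r \<inter> E \<subseteq> U" and x0: "x0 \<in> E"
    by (auto simp: openin_contains_ball)
  then obtain r where r: "r > 0" "ball x0 r \<inter> E \<subseteq> U" by blast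
  have near: "\<exists>z\<in>F m. norm (x - z) < \<delta>" if "x \<in> E" "norm (x - x0) < r" "\<delta> > 0" for x \<delta>
  proof -
    have "x \<in> closure (F m)" using that r U by (auto simp: dist_norm norm_minus_commute)
    then show ?thesis
      using that(3) by (auto simp: closure_approachable dist_norm norm_minus_commute)
  qed
  have main: "\<exists>y\<in>E. norm (x - y) < \<delta> \<and> (\<forall>n. norm (S n y) \<le> real m * t)"
    if x: "x \<in> E" and t: "t > 0" and xr: "norm x < r * t" and \<delta>: "\<delta> > 0" for x t \<delta>
  proof -
    define w where "w = (1 / t) *\<^sub>R x"
    have w: "w \<in> E" "norm w < r" "x = t *\<^sub>R w"
      using x t xr E by (auto simp: w_def subspace_scale field_simps)
    have "\<delta> / t > 0" using \<delta> t by simp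
    \<comment> \<open>Density is known near \<open>x0\<close> only; approximating both
      \<open>x0 + w\<close> and \<open>x0 - w\<close> and taking half the difference moves it to the
      origin.\<close>
    with near[of "x0 + w" "\<delta> / t"] near[of "x0 - w" "\<delta> / t"] obtain p q
      where p: "p \<in> F m" "norm (x0 + w - p) < \<delta> / t"
        and q: "q \<in> F m" "norm (x0 - w - q) < \<delta> / t"
      using w x0 E by (auto simp: subspace_add subspace_diff)
    let ?y = "(t / 2) *\<^sub>R (p - q)"
    have pqE: "p \<in> E" "q \<in> E" using p q by (auto simp: F_def)
    have yE: "?y \<in> E" using pqE E by (simp add: subspace_diff subspace_scale)
    have "x - ?y = (t / 2) *\<^sub>R ((x0 + w - p) - (x0 - w - q))"
    proof -
      have "t / 2 + t / 2 = t" by simp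
      then have "(t / 2) *\<^sub>R w + (t / 2) *\<^sub>R w = x" by (metis scaleR_add_left w(3))
      then show ?thesis by (simp add: scaleR_diff_right scaleR_add_right algebra_simps)
    qed
    then have "norm (x - ?y) = (t / 2) * norm ((x0 + w - p) - (x0 - w - q))"
      using t by simp
    also have "\<dots> < (t / 2) * (\<delta> / t + \<delta> / t)"
      using t p q by (intro mult_strict_left_mono order.strict_trans1[OF norm_triangle_ineq4]) auto
    also have "\<dots> = \<delta>" using t by simp
    finally have "norm (x - ?y) < \<delta>" .
    moreover have "norm (S n ?y) \<le> real m * t" for n
    proof -
      have "coeff_fun e k ?y = (t / 2) * (coeff_fun e k p - coeff_fun e k q)" for k
        by (simp only: coeff_fun_scaleR[OF basis E subspace_diff[OF E pqE]] coeff_fun_diff[OF basis E pqE])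
      then have "S n ?y = (t / 2) *\<^sub>R (S n p - S n q)"
        by (simp only: S_def sum_subtractf[symmetric] scaleR_diff_left[symmetric]
            scaleR_sum_right scaleR_scaleR)
      then have "norm (S n ?y) = (t / 2) * norm (S n p - S n q)" using t by simp
      also have "\<dots> \<le> (t / 2) * (real m + real m)"
        using t p q by (intro mult_left_mono order.trans[OF norm_triangle_ineq4] add_mono)
          (auto simp: F_def)
      finally show ?thesis by (simp add: mult.commute)
    qed
    ultimately show ?thesis using yE by blast
  qed
  show ?thesis
    by (rule exI[of _ r], rule conjI[OF r(1)], rule exI[of _ "real m"], rule conjI[OF of_nat_0_le_iff])
      (use main in blast)
qed

lemma coeff_fun_bounded_on_ball:
  fixes E :: "'a::banach set"
  assumes "subspace E" "closed E" "schauder_basis_of E e"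
  shows "\<exists>r>0. \<exists>C. \<forall>x\<in>E. norm x < r \<longrightarrow> \<bar>coeff_fun e k x\<bar> \<le> C"
proof -
  note E = assms(1) and basis = assms(3)
  define S where "S n x = (\<Sum>k<n. coeff_fun e k x *\<^sub>R e k)" for n x
  from partial_sums_bounded_dense[OF assms] obtain r M where r: "r > 0" and M: "M \<ge> 0"
    and "\<forall>x\<in>E. \<forall>t>0. norm x < r * t \<longrightarrow>
      (\<forall>\<delta>>0. \<exists>y\<in>E. norm (x - y) < \<delta> \<and> (\<forall>n. norm (S n y) \<le> M * t))"
    unfolding S_def by blast
  then have dense: "\<exists>y\<in>E. norm (x - y) < \<delta> \<and> (\<forall>n. norm (S n y) \<le> M * t)"
    if "x \<in> E" "t > 0" "norm x < r * t" "\<delta> > 0" for x t \<delta>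
    using that by blast
  have "\<bar>coeff_fun e k x\<bar> \<le> 4 * M / norm (e k)" if x: "x \<in> E" "norm x < r" for x
  proof -
    \<comment> \<open>\<open>w i\<close> is the remainder after \<open>i\<close> approximations. As
      \<open>norm (w i) < r * (1/2)^i\<close>, density with \<open>t = (1/2)^i\<close> gives an
      approximant \<open>w i - w (Suc i)\<close> whose partial sums are bounded by
      \<open>M * (1/2)^i\<close>.\<close>
    have "\<exists>w. \<forall>i. (w i \<in> E \<and> norm (w i) < r * (1/2)^i \<and> (i = 0 \<longrightarrow> w i = x)) \<and>
        (\<forall>n. norm (S n (w i - w (Suc i))) \<le> M * (1/2)^i)"
    proof (rule dependent_nat_choice)
      fix v i
      assume v: "v \<in> E \<and> norm v < r * (1/2)^i \<and> (i = 0 \<longrightarrow> v = x)"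
      with dense[of v "(1/2)^i" "r * (1/2)^Suc i"] r obtain y
        where "y \<in> E" "norm (v - y) < r * (1/2)^Suc i" "\<forall>n. norm (S n y) \<le> M * (1/2)^i"
        by auto
      then show "\<exists>w. (w \<in> E \<and> norm w < r * (1/2)^Suc i \<and> (Suc i = 0 \<longrightarrow> w = x)) \<and>
          (\<forall>n. norm (S n (v - w)) \<le> M * (1/2)^i)"
        using v E by (intro exI[of _ "v - y"]) (auto simp: subspace_diff)
    qed (use x in auto)
    then obtain w where w: "\<And>i. w i \<in> E" "\<And>i. norm (w i) < r * (1/2)^i" "w 0 = x"
      and Sw: "\<And>i n. norm (S n (w i - w (Suc i))) \<le> M * (1/2)^i"
      by blast
    define y where "y i = w i - w (Suc i)" for i
    have y: "y i \<in> E" "norm (S n (y i)) \<le> M * (1/2)^i" for i n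
      using w(1) Sw E by (auto simp: y_def subspace_diff)
    have "(\<lambda>i. norm (w i)) \<longlonglongrightarrow> 0"
    proof (rule tendsto_sandwich[OF _ _ tendsto_const])
      show "(\<lambda>i. r * (1/2)^i) \<longlonglongrightarrow> 0"
        by (intro tendsto_mult_right_zero LIMSEQ_realpow_zero) auto
      show "\<forall>\<^sub>F i in sequentially. norm (w i) \<le> r * (1/2)^i"
        using w(2) by (intro always_eventually allI less_imp_le)
    qed simp
    then have "w \<longlonglongrightarrow> 0" by (simp add: tendsto_norm_zero_iff)
    then have "(\<lambda>I. x - w I) \<longlonglongrightarrow> x - 0" by (intro tendsto_intros)
    moreover have "(\<Sum>i<I. y i) = x - w I" for I
      using w(3) by (induction I) (auto simp: y_def)
    ultimately have ysum: "(\<lambda>I. \<Sum>i<I. y i) \<longlonglongrightarrow> x" by simp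
    \<comment> \<open>A coefficient is read off from the difference of two consecutive partial
      sums.\<close>
    have coeff: "\<bar>coeff_fun e j (y i)\<bar> \<le> 2 * M / norm (e j) * (1/2)^i" for i j
    proof -
      have "coeff_fun e j (y i) *\<^sub>R e j = S (Suc j) (y i) - S j (y i)"
        by (simp add: S_def)
      then have "\<bar>coeff_fun e j (y i)\<bar> * norm (e j) = norm (S (Suc j) (y i) - S j (y i))"
        by (metis norm_scaleR)
      also have "\<dots> \<le> M * (1/2)^i + M * (1/2)^i"
        by (intro order.trans[OF norm_triangle_ineq4] add_mono y)
      finally show ?thesis
        using basis_nonzero[OF basis E, of j] by (simp add: field_simps)
    qed
    have geom: "(\<lambda>i. 2 * M / norm (e j) * (1/2)^i) sums (4 * M / norm (e j))" for j
      using sums_mult[OF geometric_sums[of "1/2::real"], of "2 * M / norm (e j)"] by simp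
    have sumab: "summable (\<lambda>i. \<bar>coeff_fun e j (y i)\<bar>)" for j
      by (rule summable_comparison_test'[OF sums_summable[OF geom[of j]], of 0]) (use coeff in auto)
    then have suma: "summable (\<lambda>i. coeff_fun e j (y i))" for j
      by (rule summable_rabs_cancel)
    \<comment> \<open>Adding the expansions of the \<open>y i\<close> coefficientwise gives a
      candidate \<open>d\<close> for the coefficients of \<open>x\<close>. Uniform convergence
      permits interchanging the sum over \<open>i\<close> with the limit of the partial sums, so
      \<open>d\<close> does expand \<open>x\<close>; uniqueness then identifies it.\<close>
    define d where "d j = (\<Sum>i. coeff_fun e j (y i))" for j
    have unif: "uniform_limit UNIV (\<lambda>I n. \<Sum>i<I. S n (y i)) (\<lambda>n. \<Sum>i. S n (y i)) sequentially"
    proof (rule Weierstrass_m_test)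
      show "norm (S n (y i)) \<le> M * (1/2)^i" for n i by (rule y)
      show "summable (\<lambda>i. M * (1/2::real)^i)" by (intro summable_mult summable_geometric) simp
    qed
    have "(\<lambda>n. \<Sum>i<I. S n (y i)) \<longlonglongrightarrow> (\<Sum>i<I. y i)" for I
      using coeff_fun_sums[OF basis y(1)] by (intro tendsto_sum) (simp add: sums_def S_def)
    then have "(\<lambda>n. \<Sum>i. S n (y i)) \<longlonglongrightarrow> x"
      by (intro swap_uniform_limit'[OF always_eventually[OF allI] ysum unif]) simp_all
    moreover have "(\<Sum>i. S n (y i)) = (\<Sum>j<n. d j *\<^sub>R e j)" for n
      unfolding S_def d_def
      by (subst suminf_sum) (auto simp: suminf_scaleR_left suma intro: summable_scaleR_left)
    ultimately have "(\<lambda>j. d j *\<^sub>R e j) sums x" by (simp add: sums_def)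
    then have "coeff_fun e k x = d k" by (rule coeff_fun_unique[OF basis x(1)])
    also have "\<bar>d k\<bar> \<le> (\<Sum>i. \<bar>coeff_fun e k (y i)\<bar>)"
      unfolding d_def by (rule summable_rabs[OF sumab])
    also have "\<dots> \<le> (\<Sum>i. 2 * M / norm (e k) * (1/2)^i)"
      by (rule suminf_le[OF coeff sumab sums_summable[OF geom]])
    also have "\<dots> = 4 * M / norm (e k)" by (rule sums_unique[OF geom, symmetric])
    finally show ?thesis .
  qed
  with r show ?thesis by blast
qed

lemma coeff_fun_continuous:
  fixes E :: "'a::banach set"
  assumes "subspace E" "closed E" "schauder_basis_of E e"
    and "\<And>k. f k \<in> E" "f \<longlonglongrightarrow> x"
  shows "(\<lambda>k. coeff_fun e n (f k)) \<longlonglongrightarrow> coeff_fun e n x"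
proof -
  note E = assms(1) and basis = assms(3)
  have x: "x \<in> E" using assms closed_sequentially by blast
  from coeff_fun_bounded_on_ball[OF assms(1-3)] obtain r C
    where r: "r > 0" and C: "\<And>x. x \<in> E \<Longrightarrow> norm x < r \<Longrightarrow> \<bar>coeff_fun e n x\<bar> \<le> C" by blast
  have bd: "\<bar>coeff_fun e n y\<bar> \<le> C * 2 / r * norm y" if "y \<in> E" for y
  proof (cases "y = 0")
    case False
    \<comment> \<open>Rescaling to norm \<open>r / 2\<close> turns the bound on a ball into a bound
      proportional to \<open>norm y\<close>.\<close>
    let ?t = "r / (2 * norm y)"
    have "\<bar>coeff_fun e n (?t *\<^sub>R y)\<bar> \<le> C"
      using that E False r by (intro C) (auto simp: subspace_scale)
    then show ?thesis
      using False r by (simp add: coeff_fun_scaleR[OF basis E that] abs_mult field_simps)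
  qed (simp add: coeff_fun_zero[OF basis E])
  have "(\<lambda>k. coeff_fun e n (f k) - coeff_fun e n x) \<longlonglongrightarrow> 0"
  proof (rule Lim_null_comparison)
    show "\<forall>\<^sub>F k in sequentially. norm (coeff_fun e n (f k) - coeff_fun e n x) \<le> C * 2 / r * norm (f k - x)"
      using bd[of "f k - x" for k] assms(4) x E
      by (auto simp: coeff_fun_diff[OF basis E] subspace_diff)
    show "(\<lambda>k. C * 2 / r * norm (f k - x)) \<longlonglongrightarrow> 0"
      using assms(5) by (intro tendsto_mult_right_zero tendsto_norm_zero LIM_zero)
  qed
  then show ?thesis by (rule LIM_zero_cancel)
qed

subsection \<open>Unconditional bases\<close>

text \<open>Each coordinate in [-1, 1] is a convex combination of 1 and -1, so induction on
  \<open>D\<close> pushes the point, one coordinate at a time, to the vertices of the cube;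
  coordinates outside \<open>D\<close> stay frozen.\<close>

lemma convex_le_on_cube:
  fixes Q :: "('i \<Rightarrow> real) \<Rightarrow> real"
  assumes "finite D"
    and conv: "\<And>\<mu> \<nu> s t. 0 \<le> s \<Longrightarrow> 0 \<le> t \<Longrightarrow> s + t = 1 \<Longrightarrow>
        Q (\<lambda>n. s * \<mu> n + t * \<nu> n) \<le> s * Q \<mu> + t * Q \<nu>"
    and vert: "\<And>\<mu>. (\<And>n. n \<in> D \<Longrightarrow> \<bar>\<mu> n\<bar> = 1) \<Longrightarrow> (\<And>n. n \<notin> D \<Longrightarrow> \<mu> n = \<theta> n) \<Longrightarrow> Q \<mu> \<le> c"
    and "\<And>n. n \<in> D \<Longrightarrow> \<bar>\<theta> n\<bar> \<le> 1"
  shows "Q \<theta> \<le> c"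
  using assms(1,3,4)
proof (induction D arbitrary: \<theta> rule: finite_induct)
  case empty
  then show ?case by auto
next
  case (insert m D)
  have *: "Q (\<theta>(m := z)) \<le> c" if "\<bar>z\<bar> = 1" for z
  proof (rule insert.IH)
    fix \<mu> :: "'i \<Rightarrow> real"
    assume "\<And>n. n \<in> D \<Longrightarrow> \<bar>\<mu> n\<bar> = 1" "\<And>n. n \<notin> D \<Longrightarrow> \<mu> n = (\<theta>(m := z)) n"
    then show "Q \<mu> \<le> c"
      using that insert.hyps by (intro insert.prems(1)) auto
  qed (use insert in auto)
  \<comment> \<open>\<open>t\<close> is the weight with
    \<open>t * 1 + (1 - t) * (-1) = \<theta> m\<close>.\<close>
  define t where "t = (1 + \<theta> m) / 2"
  have t: "0 \<le> t" "0 \<le> 1 - t"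
    using insert.prems(2)[of m] by (auto simp: t_def)
  have "Q \<theta> = Q (\<lambda>n. t * (\<theta>(m := 1)) n + (1 - t) * (\<theta>(m := -1)) n)"
    by (rule arg_cong[of _ _ Q]) (auto simp: t_def fun_eq_iff field_simps)
  also have "\<dots> \<le> t * Q (\<theta>(m := 1)) + (1 - t) * Q (\<theta>(m := -1))"
    using t by (intro conv) auto
  also have "\<dots> \<le> t * c + (1 - t) * c"
    using t by (intro add_mono mult_left_mono *) auto
  finally show ?case by (simp add: algebra_simps)
qed

text \<open>Unconditionality yields some expansion \<open>c\<close> of \<open>x\<close> along the
  permuted basis. Applying the continuous functionals of \<open>e\<close> to its partial sums shows
  that \<open>c n\<close> is the original coefficient at \<open>\<sigma> n\<close>.\<close>

lemma unconditional_sums_permuted: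
  fixes E :: "'a::banach set"
  assumes "subspace E" "closed E" "schauder_basis_of E e" "unconditional e" "x \<in> E" "bij \<sigma>"
  shows "(\<lambda>n. coeff_fun e (\<sigma> n) x *\<^sub>R e (\<sigma> n)) sums x"
proof -
  note E = assms(1) and basis = assms(3)
  have eE: "e n \<in> E" for n using basis by (auto simp: schauder_basis_of_def)
  have "(\<lambda>n. \<Sum>k<n. coeff_fun e k x *\<^sub>R e k) \<longlonglongrightarrow> x"
    using coeff_fun_sums[OF basis assms(5)] by (simp add: sums_def)
  moreover have "(\<Sum>k<n. coeff_fun e k x *\<^sub>R e k) \<in> span (range e)" for n
    by (intro span_sum span_scale span_base) auto
  ultimately have "x \<in> closure (span (range e))"
    unfolding closure_sequential
    by (intro exI[of _ "\<lambda>n. \<Sum>k<n. coeff_fun e k x *\<^sub>R e k"]) simp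
  moreover have "range (e \<circ> \<sigma>) = range e"
    using bij_is_surj[OF assms(6)] by (metis image_comp)
  moreover have "basic_sequence (e \<circ> \<sigma>)" using assms(4,6) by (simp add: unconditional_def)
  ultimately obtain c where c: "(\<lambda>n. c n *\<^sub>R e (\<sigma> n)) sums x"
    using coeff_fun_sums[of "closure (span (range (e \<circ> \<sigma>)))" "e \<circ> \<sigma>" x]
    unfolding basic_sequence_def comp_apply by metis
  have "coeff_fun e (\<sigma> n) x = c n" for n
  proof (rule LIMSEQ_unique)
    show "(\<lambda>K. coeff_fun e (\<sigma> n) (\<Sum>k<K. c k *\<^sub>R e (\<sigma> k))) \<longlonglongrightarrow> coeff_fun e (\<sigma> n) x"
      using c E eE by (intro coeff_fun_continuous[OF assms(1-3)])
        (auto simp: sums_def intro: subspace_sum subspace_scale)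
    have "coeff_fun e (\<sigma> n) (\<Sum>k<K. c k *\<^sub>R e (\<sigma> k)) = c n" if "n < K" for K
    proof -
      have "coeff_fun e (\<sigma> n) (\<Sum>k<K. c k *\<^sub>R e (\<sigma> k)) =
          (\<Sum>k<K. c k * (if \<sigma> n = \<sigma> k then 1 else 0))"
        using E eE by (subst coeff_fun_sum[OF basis E])
          (auto simp: subspace_scale coeff_fun_scaleR[OF basis E] coeff_fun_basis[OF basis])
      also have "\<dots> = (\<Sum>k<K. if n = k then c k else 0)"
        using bij_is_inj[OF assms(6)] by (intro sum.cong) (auto simp: inj_eq)
      finally show ?thesis using that by simp
    qed
    then show "(\<lambda>K. coeff_fun e (\<sigma> n) (\<Sum>k<K. c k *\<^sub>R e (\<sigma> k))) \<longlonglongrightarrow> c n"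
      by (intro tendsto_eventually) (auto simp: eventually_at_top_dense)
  qed
  then show ?thesis using c by simp
qed

text \<open>Used to arrange a bad subset of a block in consecutive positions: biject the two subsets
  and, separately, their complements.\<close>

lemma bij_betw_mapping_subset:
  assumes "finite B" "U \<subseteq> B" "V \<subseteq> B" "card U = card V"
  shows "\<exists>f. bij_betw f B B \<and> f ` U = V"
proof -
  have fin: "finite U" "finite V" using assms finite_subset by blast+
  then obtain g where g: "bij_betw g U V"
    using assms(4) finite_same_card_bij by blast
  have "card (B - U) = card (B - V)"
    using assms fin by (simp add: card_Diff_subset)
  then obtain h where h: "bij_betw h (B - U) (B - V)"
    using assms(1) finite_same_card_bij by (metis finite_Diff)
  let ?f = "\<lambda>x. if x \<in> U then g x else h x"
  have "bij_betw ?f (U \<union> (B - U)) (V \<union> (B - V))"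
    by (rule bij_betw_disjoint_Un[OF g h]) auto
  then have "bij_betw ?f B B" using assms by (simp add: Un_absorb1)
  moreover have "?f ` U = V" using g by (auto simp: bij_betw_def)
  ultimately show ?thesis by blast
qed

lemma strict_mono_blocks:
  fixes p :: "nat \<Rightarrow> nat"
  assumes "strict_mono p" "p 0 \<le> n"
  shows "\<exists>!k. n \<in> {p k..<p (Suc k)}"
proof (rule ex_ex1I)
  have "n < p (Suc n)" using strict_mono_imp_increasing[OF assms(1), of "Suc n"] by simp
  define j where "j = (LEAST j. n < p j)"
  have j: "n < p j" unfolding j_def by (rule LeastI) fact
  then obtain k where k: "j = Suc k" using assms(2) by (cases j) auto
  then have "\<not> n < p k" using not_less_Least[of k "\<lambda>j. n < p j"] by (simp add: j_def)
  then show "\<exists>k. n \<in> {p k..<p (Suc k)}" using j k by (intro exI[of _ k]) auto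
next
  have mono: "p i \<le> p j" if "i \<le> j" for i j
    using that assms(1) by (simp add: strict_mono_less_eq)
  fix k l assume *: "n \<in> {p k..<p (Suc k)}" "n \<in> {p l..<p (Suc l)}"
  have "\<not> k < l" using * mono[of "Suc k" l] by auto
  moreover have "\<not> l < k" using * mono[of "Suc l" k] by auto
  ultimately show "k = l" by simp
qed

text \<open>Each index lies in exactly one block, so permutations of the single blocks glue
  together.\<close>

lemma bij_from_blocks:
  fixes p :: "nat \<Rightarrow> nat"
  assumes p: "strict_mono p" "p 0 = 0"
    and f: "\<And>k. bij_betw (f k) {p k..<p (Suc k)} {p k..<p (Suc k)}"
  shows "\<exists>\<sigma>. bij \<sigma> \<and> (\<forall>k. \<forall>n\<in>{p k..<p (Suc k)}. \<sigma> n = f k n)"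
proof -
  let ?B = "\<lambda>k. {p k..<p (Suc k)}"
  have ex1: "\<exists>!k. n \<in> ?B k" for n by (rule strict_mono_blocks) (use p in auto)
  define \<sigma> where "\<sigma> n = f (THE k. n \<in> ?B k) n" for n
  have \<sigma>: "\<sigma> n = f k n" if "n \<in> ?B k" for n k
    using the1_equality[OF ex1 that] by (simp add: \<sigma>_def)
  have mem: "\<sigma> n \<in> ?B k" if "n \<in> ?B k" for n k
    using bij_betwE[OF f[of k]] that by (simp add: \<sigma>)
  have "inj \<sigma>"
  proof (rule injI)
    fix m n assume eq: "\<sigma> m = \<sigma> n"
    obtain k l where kl: "m \<in> ?B k" "n \<in> ?B l" using ex1 by blast
    then have "k = l" using mem[OF kl(1)] mem[OF kl(2)] eq ex1[of "\<sigma> n"] by auto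
    then show "m = n"
      using kl eq \<sigma> bij_betw_imp_inj_on[OF f[of k]] by (metis inj_onD)
  qed
  moreover have "y \<in> range \<sigma>" for y
  proof -
    obtain k where "y \<in> ?B k" using ex1 by blast
    then obtain n where "n \<in> ?B k" "y = f k n"
      using bij_betw_imp_surj_on[OF f[of k]] by blast
    then show ?thesis using \<sigma> by (metis rangeI)
  qed
  ultimately have "bij \<sigma>" by (auto simp: bij_def)
  with \<sigma> show ?thesis by blast
qed

text \<open>
  If the tails were not small, a permutation moving a bad set to the front of its block, for
  infinitely many blocks, would destroy the Cauchy property of the permuted expansion.
\<close>

lemma unconditional_finite_sums_small:
  fixes E :: "'a::banach set"
  assumes "subspace E" "closed E" "schauder_basis_of E e" "unconditional e" "x \<in> E" "0 < \<epsilon>"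
  shows "\<exists>N. \<forall>D. finite D \<longrightarrow> D \<subseteq> {N..} \<longrightarrow> norm (\<Sum>n\<in>D. coeff_fun e n x *\<^sub>R e n) \<le> \<epsilon>"
proof (rule ccontr)
  let ?v = "\<lambda>n. coeff_fun e n x *\<^sub>R e n"
  assume "\<not> ?thesis"
  then have "\<forall>N. \<exists>D. finite D \<and> D \<subseteq> {N..} \<and> \<epsilon> < norm (sum ?v D)"
    by (auto simp: not_le)
  then obtain D where D: "\<And>N. finite (D N)" "\<And>N. D N \<subseteq> {N..}" "\<And>N. \<epsilon> < norm (sum ?v (D N))"
    by metis
  \<comment> \<open>\<open>p (Suc k)\<close> lies beyond \<open>p k\<close> and all of
    \<open>D (p k)\<close>, while \<open>D (p k)\<close> starts at \<open>p k\<close> or later;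
    hence the \<open>k\<close>-th block contains \<open>D (p k)\<close>.\<close>
  define p where "p = rec_nat 0 (\<lambda>_ N. Suc (Max (insert N (D N))))"
  have p0: "p 0 = 0" and pS: "p (Suc k) = Suc (Max (insert (p k) (D (p k))))" for k
    by (simp_all add: p_def)
  have "i < p (Suc k)" if "i \<in> insert (p k) (D (p k))" for i k
    using Max_ge[OF _ that] D(1) by (simp add: pS less_Suc_eq_le)
  then have DB: "D (p k) \<subseteq> {p k..<p (Suc k)}" and "p k < p (Suc k)" for k
    using D(2)[of "p k"] by auto
  then have p: "strict_mono p" by (simp add: strict_mono_Suc_iff)
  have sub: "{p k..<p k + card (D (p k))} \<subseteq> {p k..<p (Suc k)}" for k
    using card_mono[OF _ DB[of k]] by auto
  have "\<exists>f. bij_betw f {p k..<p (Suc k)} {p k..<p (Suc k)} \<and>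
      f ` {p k..<p k + card (D (p k))} = D (p k)" for k
    by (rule bij_betw_mapping_subset) (use sub DB in auto)
  then obtain f where f: "\<And>k. bij_betw (f k) {p k..<p (Suc k)} {p k..<p (Suc k)}"
      "\<And>k. f k ` {p k..<p k + card (D (p k))} = D (p k)"
    by metis
  from bij_from_blocks[OF p p0 f(1)] obtain \<sigma> where \<sigma>: "bij \<sigma>"
    "\<And>k n. n \<in> {p k..<p (Suc k)} \<Longrightarrow> \<sigma> n = f k n" by blast
  have "summable (\<lambda>n. ?v (\<sigma> n))"
    using unconditional_sums_permuted[OF assms(1-5) \<sigma>(1)] by (simp add: sums_iff)
  then obtain N where N: "\<And>m n. m \<ge> N \<Longrightarrow> norm (\<Sum>i=m..<n. ?v (\<sigma> i)) < \<epsilon>"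
    using assms(6) unfolding summable_Cauchy by blast
  \<comment> \<open>The first \<open>card (D (p N))\<close> positions of the block are mapped onto
    the bad set, so the bad sum is a sum of consecutive terms of the permuted series, starting at or
    beyond \<open>N\<close>.\<close>
  let ?I = "{p N..<p N + card (D (p N))}"
  have "\<sigma> ` ?I = D (p N)"
    using sub[of N] \<sigma>(2)[of _ N] f(2)[of N] by (metis image_cong subsetD)
  then have "sum ?v (D (p N)) = (\<Sum>i\<in>?I. ?v (\<sigma> i))"
    using sum.reindex[OF inj_on_subset[OF bij_is_inj[OF \<sigma>(1)]], of ?I ?v] by simp
  moreover have "N \<le> p N" by (rule strict_mono_imp_increasing[OF p])
  ultimately show False using N[of "p N" "p N + card (D (p N))"] D(3)[of "p N"] by simp
qed

text \<open>For signs the sum splits into a positive and a negative part, each a plain finite sum of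
  norm at most \<open>\<epsilon> / 2\<close>. Multipliers in [-1, 1] are reduced to signs by
  convexity of the norm.\<close>

lemma unconditional_bounded_multiplier_sums_small:
  fixes E :: "'a::banach set"
  assumes "subspace E" "closed E" "schauder_basis_of E e" "unconditional e" "x \<in> E" "0 < \<epsilon>"
  shows "\<exists>N. \<forall>D \<mu>. finite D \<longrightarrow> D \<subseteq> {N..} \<longrightarrow> (\<forall>n\<in>D. \<bar>\<mu> n\<bar> \<le> 1) \<longrightarrow>
    norm (\<Sum>n\<in>D. (\<mu> n * coeff_fun e n x) *\<^sub>R e n) \<le> \<epsilon>"
proof -
  let ?v = "\<lambda>n. coeff_fun e n x *\<^sub>R e n"
  from unconditional_finite_sums_small[OF assms(1-5), of "\<epsilon> / 2"] assms(6) obtain N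
    where N: "\<And>D. finite D \<Longrightarrow> D \<subseteq> {N..} \<Longrightarrow> norm (sum ?v D) \<le> \<epsilon> / 2"
    by auto
  have "norm (\<Sum>n\<in>D. (\<mu> n * coeff_fun e n x) *\<^sub>R e n) \<le> \<epsilon>"
    if D: "finite D" "D \<subseteq> {N..}" and \<mu>: "\<forall>n\<in>D. \<bar>\<mu> n\<bar> \<le> 1" for D \<mu>
  proof (rule convex_le_on_cube[where D = D and
        Q = "\<lambda>\<mu>. norm (\<Sum>n\<in>D. (\<mu> n * coeff_fun e n x) *\<^sub>R e n)"])
    fix \<mu> \<nu> :: "nat \<Rightarrow> real" and s t :: real
    assume st: "0 \<le> s" "0 \<le> t"
    have "(\<Sum>n\<in>D. ((s * \<mu> n + t * \<nu> n) * coeff_fun e n x) *\<^sub>R e n) =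
        s *\<^sub>R (\<Sum>n\<in>D. (\<mu> n * coeff_fun e n x) *\<^sub>R e n) + t *\<^sub>R (\<Sum>n\<in>D. (\<nu> n * coeff_fun e n x) *\<^sub>R e n)"
      by (simp add: scaleR_sum_right sum.distrib algebra_simps)
    also have "norm \<dots> \<le> s * norm (\<Sum>n\<in>D. (\<mu> n * coeff_fun e n x) *\<^sub>R e n) +
        t * norm (\<Sum>n\<in>D. (\<nu> n * coeff_fun e n x) *\<^sub>R e n)"
      using st by (intro order.trans[OF norm_triangle_ineq]) simp
    finally show "norm (\<Sum>n\<in>D. ((s * \<mu> n + t * \<nu> n) * coeff_fun e n x) *\<^sub>R e n) \<le> \<dots>" .
  next
    fix \<mu> :: "nat \<Rightarrow> real"
    assume \<mu>: "\<And>n. n \<in> D \<Longrightarrow> \<bar>\<mu> n\<bar> = 1"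
    let ?P = "{n\<in>D. \<mu> n = 1}" and ?M = "{n\<in>D. \<mu> n = -1}"
    have "\<mu> n = 1 \<or> \<mu> n = -1" if "n \<in> D" for n using \<mu>[OF that] by linarith
    then have "?P \<union> ?M = D" "?P \<inter> ?M = {}" by auto
    then have "sum g D = sum g ?P + sum g ?M" for g :: "nat \<Rightarrow> 'a"
      using D(1) sum.union_disjoint[of ?P ?M g] by simp
    then have "(\<Sum>n\<in>D. (\<mu> n * coeff_fun e n x) *\<^sub>R e n) =
        (\<Sum>n\<in>?P. (\<mu> n * coeff_fun e n x) *\<^sub>R e n) + (\<Sum>n\<in>?M. (\<mu> n * coeff_fun e n x) *\<^sub>R e n)" .
    also have "\<dots> = sum ?v ?P - sum ?v ?M" by (simp add: sum_negf)
    also have "norm \<dots> \<le> \<epsilon> / 2 + \<epsilon> / 2"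
      using D by (intro order.trans[OF norm_triangle_ineq4] add_mono N) auto
    finally show "norm (\<Sum>n\<in>D. (\<mu> n * coeff_fun e n x) *\<^sub>R e n) \<le> \<epsilon>" by simp
  qed (use D \<mu> in auto)
  then show ?thesis by blast
qed

subsection \<open>Order bounds for greedy sums\<close>

text \<open>
  Gliding hump: if the conclusion fails, there are bad blocks \<open>D k\<close> with signs \<open>s k\<close> whose
  coefficients, multiplied by \<open>2 ^ k\<close>, decrease strictly from block to block and still give
  a convergent expansion. A greedy set of a single block, together with all previous blocks, is
  greedy for the sum \<open>z\<close> of these blocks, so the order bound for \<open>z\<close> contradicts the factors \<open>2 ^ k\<close>.
\<close>

lemma max_greedy_signs_small:
  fixes E :: "'a::banach_lattice set"
  assumes E: "subspace E" "closed E" and basis: "schauder_basis_of E e"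
    and coeff_null: "\<And>x. x \<in> E \<Longrightarrow> (\<lambda>n. coeff_fun e n x) \<longlonglongrightarrow> 0"
    and aqg: "absolutely_quasi_greedy E e"
    and tail: "\<And>\<epsilon>. 0 < \<epsilon> \<Longrightarrow> \<exists>N. \<forall>D \<mu>. finite D \<longrightarrow> D \<subseteq> {N..} \<longrightarrow> (\<forall>n\<in>D. \<bar>\<mu> n\<bar> \<le> 1) \<longrightarrow>
      norm (\<Sum>n\<in>D. (\<mu> n * b n) *\<^sub>R e n) \<le> \<epsilon>"
    and b: "b \<longlonglongrightarrow> 0" and \<eta>: "0 < \<eta>"
  shows "\<exists>N. \<forall>D s. finite D \<longrightarrow> D \<subseteq> {N..} \<longrightarrow> (\<forall>n\<in>D. b n \<noteq> 0 \<and> \<bar>s n\<bar> = 1) \<longrightarrow>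
      norm (max_greedy b e D (\<lambda>n. s n * b n)) \<le> \<eta>"
proof (rule ccontr)
  assume "\<not> ?thesis"
  then have bad: "\<exists>D s. finite D \<and> D \<subseteq> {N..} \<and> (\<forall>n\<in>D. b n \<noteq> 0 \<and> \<bar>s n\<bar> = 1) \<and>
      \<eta> < norm (max_greedy b e D (\<lambda>n. s n * b n))" for N
    by (simp add: not_le)
  \<comment> \<open>The bound \<open>(1/4)^k\<close> leaves \<open>(1/2)^k\<close> after the
    coefficients are enlarged by \<open>2^k\<close>, which makes the enlarged series converge.
    Nonemptiness lets comparisons of consecutive blocks be chained.\<close>
  define good where "good k D s \<longleftrightarrow> finite D \<and> D \<noteq> {} \<and> (\<forall>n\<in>D. b n \<noteq> 0 \<and> \<bar>s n\<bar> = 1) \<and>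
      \<eta> < norm (max_greedy b e D (\<lambda>n. s n * b n)) \<and>
      (\<forall>F \<mu>. F \<subseteq> D \<longrightarrow> (\<forall>n\<in>F. \<bar>\<mu> n\<bar> \<le> 1) \<longrightarrow> norm (\<Sum>n\<in>F. (\<mu> n * b n) *\<^sub>R e n) \<le> (1/4)^k)"
    for k :: nat and D :: "nat set" and s :: "nat \<Rightarrow> real"
  have block: "\<exists>D s. good k D s \<and> D \<subseteq> {N..} \<and> (\<forall>n\<in>D. \<bar>b n\<bar> < \<delta>)" if pos: "0 < \<delta>" for k N \<delta>
  proof -
    obtain N1 where N1: "\<And>n. n \<ge> N1 \<Longrightarrow> \<bar>b n\<bar> < \<delta>"
      using LIMSEQ_D[OF b pos] by auto
    have "0 < (1/4 :: real)^k" by simp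
    from tail[OF this] obtain N2 where N2: "\<And>F \<mu>. finite F \<Longrightarrow> F \<subseteq> {N2..} \<Longrightarrow> (\<forall>n\<in>F. \<bar>\<mu> n\<bar> \<le> 1) \<Longrightarrow>
        norm (\<Sum>n\<in>F. (\<mu> n * b n) *\<^sub>R e n) \<le> (1/4)^k"
      by blast
    obtain D s where D: "finite D" "D \<subseteq> {max N (max N1 N2)..}" "\<forall>n\<in>D. b n \<noteq> 0 \<and> \<bar>s n\<bar> = 1"
        "\<eta> < norm (max_greedy b e D (\<lambda>n. s n * b n))"
      using bad[of "max N (max N1 N2)"] by blast
    have "max_greedy b e {} (\<lambda>n. s n * b n) = 0"
      by (rule antisym[OF max_greedy_le max_greedy_nonneg]) (auto simp: greedy_sets_def)
    then have "D \<noteq> {}" using D(4) \<eta> by auto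
    moreover have "norm (\<Sum>n\<in>F. (\<mu> n * b n) *\<^sub>R e n) \<le> (1/4)^k"
      if "F \<subseteq> D" "\<forall>n\<in>F. \<bar>\<mu> n\<bar> \<le> 1" for F \<mu>
      using that D(1,2) by (intro N2) (auto intro: finite_subset)
    ultimately have "good k D s" using D unfolding good_def by blast
    moreover have "D \<subseteq> {N..}" "\<forall>n\<in>D. \<bar>b n\<bar> < \<delta>" using D(2) N1 by auto
    ultimately show ?thesis by blast
  qed
  have "\<exists>f. \<forall>k. good k (fst (f k)) (snd (f k)) \<and>
      (\<forall>i\<in>fst (f k). \<forall>j\<in>fst (f (Suc k)). i < j \<and> 2 * \<bar>b j\<bar> < \<bar>b i\<bar>)"
  proof (rule dependent_nat_choice)
    show "\<exists>p. good 0 (fst p) (snd p)" using block[of 1 0 0] by auto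
  next
    fix p k assume p: "good k (fst p) (snd p)"
    \<comment> \<open>This minimum is positive as \<open>b\<close> has no zeros on the block. Half
      of it bounds \<open>b\<close> on the next block, and the factor 2 offsets the growth from
      \<open>2^k\<close> to \<open>2^Suc k\<close>.\<close>
    define \<delta> where "\<delta> = Min ((\<lambda>n. \<bar>b n\<bar>) ` fst p)"
    have "0 < \<delta>" using p by (auto simp: \<delta>_def good_def)
    have \<delta>: "\<delta> \<le> \<bar>b i\<bar>" if "i \<in> fst p" for i using p that by (auto simp: \<delta>_def good_def)
    have M: "i \<le> Max (fst p)" if "i \<in> fst p" for i using p that by (auto simp: good_def)
    obtain D s where Ds: "good (Suc k) D s" "D \<subseteq> {Suc (Max (fst p))..}" "\<forall>n\<in>D. \<bar>b n\<bar> < \<delta> / 2"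
      using block[of "\<delta> / 2"] \<open>0 < \<delta>\<close> by (metis half_gt_zero)
    have "\<forall>i\<in>fst p. \<forall>j\<in>D. i < j \<and> 2 * \<bar>b j\<bar> < \<bar>b i\<bar>"
      using Ds M \<delta> by fastforce
    then show "\<exists>q. good (Suc k) (fst q) (snd q) \<and>
        (\<forall>i\<in>fst p. \<forall>j\<in>fst q. i < j \<and> 2 * \<bar>b j\<bar> < \<bar>b i\<bar>)"
      using Ds(1) by (intro exI[of _ "(D, s)"]) simp
  qed
  then obtain f where f: "\<And>k. good k (fst (f k)) (snd (f k))"
    "\<And>k. \<forall>i\<in>fst (f k). \<forall>j\<in>fst (f (Suc k)). i < j \<and> 2 * \<bar>b j\<bar> < \<bar>b i\<bar>"
    by blast
  define D where "D k = fst (f k)" for k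
  define s where "s k = snd (f k)" for k
  have good: "good k (D k) (s k)" for k using f(1) by (simp add: D_def s_def)
  have succ: "i < j \<and> 2 * \<bar>b j\<bar> < \<bar>b i\<bar>" if "i \<in> D k" "j \<in> D (Suc k)" for k i j
    using f(2)[of k] that unfolding D_def by blast
  have D: "finite (D k)" "D k \<noteq> {}" "\<And>n. n \<in> D k \<Longrightarrow> b n \<noteq> 0 \<and> \<bar>s k n\<bar> = 1" for k
    using good[of k] by (auto simp: good_def)
  \<comment> \<open>Consecutive blocks are compared directly; for more distant ones the comparison
    passes through an element of the nonempty block before the last.\<close>
  have later: "i < j \<and> 2^l * \<bar>b j\<bar> < 2^k * \<bar>b i\<bar>" if "k < l" "i \<in> D k" "j \<in> D l" for k l i j
    using that
  proof (induction l arbitrary: j)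
    case (Suc l)
    show ?case
    proof (cases "k = l")
      case True
      then show ?thesis using succ[of i k j] Suc.prems by simp
    next
      case False
      obtain m where m: "m \<in> D l" using D(2) by blast
      have "i < m \<and> 2^l * \<bar>b m\<bar> < 2^k * \<bar>b i\<bar>"
        using Suc.IH[OF _ _ m] Suc.prems False by simp
      moreover have "m < j" "2^l * (2 * \<bar>b j\<bar>) < 2^l * \<bar>b m\<bar>"
        using succ[OF m Suc.prems(3)] by simp_all
      moreover have "2^Suc l * \<bar>b j\<bar> = 2^l * (2 * \<bar>b j\<bar>)" by simp
      ultimately show ?thesis by linarith
    qed
  qed simp
  have disj: "k = l" if "n \<in> D k" "n \<in> D l" for k l n
    using later[of k l n n] later[of l k n n] that by (cases k l rule: linorder_cases) auto
  have D_ge: "k \<le> n" if "n \<in> D k" for k n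
    using that
  proof (induction k arbitrary: n)
    case (Suc k)
    obtain m where m: "m \<in> D k" using D(2) by blast
    then show ?case using Suc.IH[OF m] succ[OF m Suc.prems] by simp
  qed simp
  \<comment> \<open>Disjointness makes the block of \<open>n\<close> unique; outside all blocks the
    default coefficient is 0.\<close>
  define c where "c n = (if \<exists>k. n \<in> D k then let k = (THE k. n \<in> D k) in 2^k * (s k n * b n) else 0)"
    for n
  have c: "c n = 2^k * (s k n * b n)" if "n \<in> D k" for n k
  proof -
    have "(THE k. n \<in> D k) = k" using that disj by blast
    then show ?thesis using that by (auto simp: c_def)
  qed
  have c0: "c n = 0" if "\<And>k. n \<notin> D k" for n using that by (simp add: c_def)
  have cabs: "\<bar>c n\<bar> = 2^k * \<bar>b n\<bar>" if "n \<in> D k" for n k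
    using c[OF that] D(3)[OF that] by (simp add: abs_mult)
  have sum_block: "(\<Sum>n\<in>F. c n *\<^sub>R e n) = 2^k *\<^sub>R (\<Sum>n\<in>F. (s k n * b n) *\<^sub>R e n)"
    if "F \<subseteq> D k" for F k
    unfolding scaleR_sum_right using that by (intro sum.cong) (auto simp: c)
  have norm_block: "norm (\<Sum>n\<in>F. c n *\<^sub>R e n) \<le> (1/2)^k" if "F \<subseteq> D k" for F k
  proof -
    have "norm (\<Sum>n\<in>F. (s k n * b n) *\<^sub>R e n) \<le> (1/4)^k"
      using good[of k] that D(3)[of _ k] unfolding good_def by (metis order.refl subsetD)
    then have "norm (\<Sum>n\<in>F. c n *\<^sub>R e n) \<le> 2^k * (1/4)^k"
      unfolding sum_block[OF that] by simp
    also have "\<dots> = (1/2)^k" by (simp flip: power_mult_distrib)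
    finally show ?thesis .
  qed
  have "summable (\<lambda>n. c n *\<^sub>R e n)"
    unfolding summable_Cauchy
  proof (intro allI impI)
    fix \<epsilon> :: real assume "0 < \<epsilon>"
    have "summable (\<lambda>k. (1/2::real)^k)" by (rule summable_geometric) simp
    then obtain K where K: "\<And>m n. m \<ge> K \<Longrightarrow> norm (\<Sum>k=m..<n. (1/2::real)^k) < \<epsilon>"
      using \<open>0 < \<epsilon>\<close> unfolding summable_Cauchy by blast
    \<comment> \<open>Choose \<open>N\<close> beyond the first \<open>K\<close> blocks. Since block
      \<open>k\<close> starts at \<open>k\<close> or later, only the blocks from \<open>K\<close> to
      \<open>n - 1\<close> can meet \<open>{m..<n}\<close> for \<open>m \<ge> N\<close>, and block
      \<open>k\<close> contributes at most \<open>(1/2)^k\<close>.\<close>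
    have "finite (\<Union>k<K. D k)" using D(1) by blast
    from this[unfolded finite_nat_set_iff_bounded] obtain N where "\<forall>n\<in>(\<Union>k<K. D k). n < N" ..
    then have N: "n < N" if "k < K" "n \<in> D k" for k n using that by blast
    have "norm (\<Sum>i=m..<n. c i *\<^sub>R e i) < \<epsilon>" if "m \<ge> N" for m n
    proof -
      let ?F = "\<lambda>k. {m..<n} \<inter> D k"
      have "{m..<n} \<inter> (\<Union>k\<in>{K..<n}. D k) = (\<Union>k\<in>{K..<n}. ?F k)" by blast
      moreover have "i \<in> (\<Union>k\<in>{K..<n}. D k)" if "i \<in> {m..<n}" "i \<in> D k" for i k
      proof -
        have "\<not> k < K" using that N[of k i] \<open>m \<ge> N\<close> by auto
        then show ?thesis using that D_ge[of i k] by (intro UN_I[of k]) auto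
      qed
      then have "c i *\<^sub>R e i = 0" if "i \<in> {m..<n} - {m..<n} \<inter> (\<Union>k\<in>{K..<n}. D k)" for i
        using that c0[of i] by auto
      ultimately have "(\<Sum>i=m..<n. c i *\<^sub>R e i) = (\<Sum>i\<in>(\<Union>k\<in>{K..<n}. ?F k). c i *\<^sub>R e i)"
        by (intro sum.mono_neutral_right) auto
      also have "\<dots> = (\<Sum>k=K..<n. \<Sum>i\<in>?F k. c i *\<^sub>R e i)"
        using disj by (intro sum.UNION_disjoint) auto
      also have "norm \<dots> \<le> (\<Sum>k=K..<n. (1/2)^k)"
        by (rule sum_norm_le) (rule norm_block, blast)
      also have "\<dots> < \<epsilon>" using K[of K n] by simp
      finally show ?thesis .
    qed
    then show "\<exists>N. \<forall>m\<ge>N. \<forall>n. norm (\<Sum>i=m..<n. c i *\<^sub>R e i) < \<epsilon>" by blast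
  qed
  then obtain z where z: "(\<lambda>n. c n *\<^sub>R e n) sums z" by (auto simp: summable_def)
  have "e n \<in> E" for n using basis by (auto simp: schauder_basis_of_def)
  then have "(\<Sum>k<n. c k *\<^sub>R e k) \<in> E" for n
    using E(1) by (intro subspace_sum subspace_scale) auto
  then have zE: "z \<in> E" by (rule closed_sequentially[OF E(2) _ z[unfolded sums_def]])
  have coeff: "coeff_fun e n z = c n" for n
    by (rule coeff_fun_unique[OF basis zE z])
  obtain u where "\<forall>A\<in>greedy_sets c UNIV. finite A \<longrightarrow> \<bar>\<Sum>n\<in>A. c n *\<^sub>R e n\<bar> \<le> u"
    using absolutely_quasi_greedy_bound[OF aqg zE coeff_null[OF zE]] unfolding coeff ..
  then have u: "\<bar>\<Sum>n\<in>A. c n *\<^sub>R e n\<bar> \<le> u" if "A \<in> greedy_sets c UNIV" "finite A" for A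
    using that by blast
  have bound: "\<eta> < (1/2)^k * norm (u + u)" for k
  proof -
    let ?T = "\<Union>i<k. D i"
    \<comment> \<open>An index outside the blocks up to \<open>k'\<close> lies in a later block,
      where \<open>c\<close> is smaller by \<open>later\<close>, or in none, where \<open>c\<close>
      vanishes.\<close>
    have le: "\<bar>c j\<bar> \<le> \<bar>c i\<bar>" if "i \<in> D k'" "j \<notin> (\<Union>i<k'. D i)" "j \<notin> D k'" for i j k'
    proof (cases "\<exists>l. j \<in> D l")
      case True
      then obtain l where l: "j \<in> D l" by blast
      then have "k' < l" using that by (metis UN_I lessThan_iff linorder_neqE_nat)
      then show ?thesis using later[OF _ that(1) l] cabs[OF l] cabs[OF that(1)] by simp
    qed (simp add: c0)
    have T: "\<bar>c j\<bar> \<le> \<bar>c i\<bar>" if "i \<in> ?T" "j \<notin> ?T" for i j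
      using that le[of i _ j] by force
    have finT: "finite ?T" using D(1) by blast
    have *: "\<bar>\<Sum>n\<in>S. (s k n * b n) *\<^sub>R e n\<bar> \<le> (1/2)^k *\<^sub>R (u + u)" if S: "S \<in> greedy_sets b (D k)" for S
    proof -
      have SD: "S \<subseteq> D k" using S by (simp add: greedy_sets_def)
      \<comment> \<open>On \<open>D k\<close> the signs drop out and \<open>\<bar>c n\<bar>\<close>
        is the constant \<open>2^k\<close> times \<open>\<bar>b n\<bar>\<close>, so \<open>c\<close>
        orders the block as \<open>b\<close> does.\<close>
      have SS: "\<bar>c j\<bar> \<le> \<bar>c i\<bar>" if "i \<in> S" "j \<notin> ?T \<union> S" for i j
      proof (cases "j \<in> D k")
        case True
        then have "\<bar>b j\<bar> \<le> \<bar>b i\<bar>" using S that by (auto simp: greedy_sets_def)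
        then show ?thesis using cabs[OF True] cabs[of i k] that SD by auto
      qed (use that SD le in blast)
      have "\<bar>c j\<bar> \<le> \<bar>c i\<bar>" if "i \<in> ?T \<union> S" "j \<notin> ?T \<union> S" for i j
        using that T[of i j] SS[of i j] by (elim UnE) auto
      then have TS: "?T \<union> S \<in> greedy_sets c UNIV" by (rule greedy_sets_UNIV_I)
      have TT: "?T \<in> greedy_sets c UNIV" using T by (rule greedy_sets_UNIV_I)
      have finS: "finite S" using SD D(1) finite_subset by blast
      have "?T \<inter> S = {}"
      proof (rule equals0I)
        fix n assume "n \<in> ?T \<inter> S"
        then obtain i where "i < k" "n \<in> D i" "n \<in> D k" using SD by blast
        then show False using disj by blast
      qed
      \<comment> \<open>Both \<open>?T \<union> S\<close> and \<open>?T\<close> are greedy for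
        \<open>c\<close>, so the sum over \<open>S\<close> is a difference of two sums with modulus
        below \<open>u\<close>; undoing the factor \<open>2^k\<close> gives the small bound.\<close>
      then have "(\<Sum>n\<in>S. c n *\<^sub>R e n) = (\<Sum>n\<in>?T \<union> S. c n *\<^sub>R e n) - (\<Sum>n\<in>?T. c n *\<^sub>R e n)"
        by (simp add: sum.union_disjoint[OF finT finS])
      then have "\<bar>\<Sum>n\<in>S. c n *\<^sub>R e n\<bar> \<le> \<bar>\<Sum>n\<in>?T \<union> S. c n *\<^sub>R e n\<bar> + \<bar>\<Sum>n\<in>?T. c n *\<^sub>R e n\<bar>"
        by (simp only: abs_triangle_ineq4)
      also have "\<dots> \<le> u + u"
        by (intro add_mono u[OF TS] u[OF TT] finite_UnI finT finS)
      finally have "\<bar>\<Sum>n\<in>S. c n *\<^sub>R e n\<bar> \<le> u + u" .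
      then have "(1/2)^k *\<^sub>R \<bar>\<Sum>n\<in>S. c n *\<^sub>R e n\<bar> \<le> (1/2)^k *\<^sub>R (u + u)"
        by (intro scaleR_left_mono) auto
      moreover have "(\<Sum>n\<in>S. (s k n * b n) *\<^sub>R e n) = (1/2)^k *\<^sub>R (\<Sum>n\<in>S. c n *\<^sub>R e n)"
        unfolding sum_block[OF SD] by (simp flip: power_mult_distrib)
      ultimately show ?thesis
        using abs_scaleR_le[of "(1/2)^k" "\<Sum>n\<in>S. c n *\<^sub>R e n"] by (auto intro: order.trans)
    qed
    have "\<eta> < norm (max_greedy b e (D k) (\<lambda>n. s k n * b n))"
      using good[of k] by (simp add: good_def)
    also have "\<dots> \<le> norm ((1/2)^k *\<^sub>R (u + u))"
      using D(1)[of k] * by (intro norm_mono_nonneg max_greedy_nonneg max_greedy_le)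
    finally show ?thesis by simp
  qed
  have "(\<lambda>k. (1/2::real)^k * norm (u + u)) \<longlonglongrightarrow> 0"
    by (intro tendsto_mult_left_zero LIMSEQ_realpow_zero) auto
  then have "\<eta> \<le> 0"
    by (rule tendsto_lowerbound) (use bound in \<open>auto intro!: always_eventually less_imp_le\<close>)
  then show False using \<eta> by simp
qed

text \<open>The sets in the maximum depend on \<open>b\<close> alone, so its norm is convex in
  \<open>\<mu>\<close> and is controlled on the cube by the sign multipliers at the
  vertices.\<close>

lemma max_greedy_multipliers_small:
  fixes E :: "'a::banach_lattice set"
  assumes "subspace E" "closed E" "schauder_basis_of E e"
    and "\<And>x. x \<in> E \<Longrightarrow> (\<lambda>n. coeff_fun e n x) \<longlonglongrightarrow> 0"
    and "absolutely_quasi_greedy E e"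
    and "\<And>\<epsilon>. 0 < \<epsilon> \<Longrightarrow> \<exists>N. \<forall>D \<mu>. finite D \<longrightarrow> D \<subseteq> {N..} \<longrightarrow> (\<forall>n\<in>D. \<bar>\<mu> n\<bar> \<le> 1) \<longrightarrow>
      norm (\<Sum>n\<in>D. (\<mu> n * b n) *\<^sub>R e n) \<le> \<epsilon>"
    and "b \<longlonglongrightarrow> 0" and "0 < \<eta>"
  shows "\<exists>N. \<forall>D \<mu>. finite D \<longrightarrow> D \<subseteq> {N..} \<longrightarrow> (\<forall>n\<in>D. b n \<noteq> 0 \<and> \<bar>\<mu> n\<bar> \<le> 1) \<longrightarrow>
      norm (max_greedy b e D (\<lambda>n. \<mu> n * b n)) \<le> \<eta>"
proof -
  from max_greedy_signs_small[OF assms] obtain N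
    where N: "\<And>D s. finite D \<Longrightarrow> D \<subseteq> {N..} \<Longrightarrow> (\<forall>n\<in>D. b n \<noteq> 0 \<and> \<bar>s n\<bar> = 1) \<Longrightarrow>
      norm (max_greedy b e D (\<lambda>n. s n * b n)) \<le> \<eta>"
    by blast
  have "norm (max_greedy b e D (\<lambda>n. \<mu> n * b n)) \<le> \<eta>"
    if D: "finite D" "D \<subseteq> {N..}" and \<mu>: "\<forall>n\<in>D. b n \<noteq> 0 \<and> \<bar>\<mu> n\<bar> \<le> 1" for D \<mu>
  proof (rule convex_le_on_cube[where D = D and
        Q = "\<lambda>\<mu>. norm (max_greedy b e D (\<lambda>n. \<mu> n * b n))"])
    fix \<mu> \<nu> :: "nat \<Rightarrow> real" and s t :: real
    assume "0 \<le> s" "0 \<le> t"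
    from norm_max_greedy_comb[OF D(1) this]
    show "norm (max_greedy b e D (\<lambda>n. (s * \<mu> n + t * \<nu> n) * b n))
        \<le> s * norm (max_greedy b e D (\<lambda>n. \<mu> n * b n)) + t * norm (max_greedy b e D (\<lambda>n. \<nu> n * b n))"
      by (simp add: algebra_simps)
  next
    fix s :: "nat \<Rightarrow> real" assume "\<And>n. n \<in> D \<Longrightarrow> \<bar>s n\<bar> = 1"
    then show "norm (max_greedy b e D (\<lambda>n. s n * b n)) \<le> \<eta>" using D \<mu> by (intro N) auto
  qed (use D \<mu> in auto)
  then show ?thesis by blast
qed

text \<open>Cut the indices into blocks whose greedy maxima have norm at most
  \<open>(1/2)^k\<close>. A greedy set meets each block in a greedy set, so the modulus of its sum
  lies below the convergent series of these maxima plus the moduli of the finitely many terms before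
  the first block.\<close>

lemma abs_sum_le_of_block_bounds:
  fixes e :: "nat \<Rightarrow> 'a::banach_lattice"
  assumes small: "\<And>\<eta>. 0 < \<eta> \<Longrightarrow> \<exists>N. \<forall>D. finite D \<longrightarrow> D \<subseteq> {N..} \<longrightarrow> (\<forall>n\<in>D. b n \<noteq> 0) \<longrightarrow>
      norm (max_greedy b e D a) \<le> \<eta>"
    and zero: "\<And>n. b n = 0 \<Longrightarrow> a n = 0"
  shows "\<exists>u. \<forall>A\<in>greedy_sets b UNIV. finite A \<longrightarrow> \<bar>\<Sum>n\<in>A. a n *\<^sub>R e n\<bar> \<le> u"
proof -
  have "\<forall>k. \<exists>N. \<forall>D. finite D \<longrightarrow> D \<subseteq> {N..} \<longrightarrow> (\<forall>n\<in>D. b n \<noteq> 0) \<longrightarrow>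
      norm (max_greedy b e D a) \<le> (1/2)^k"
    using small by simp
  then obtain N where N: "\<And>k D. finite D \<Longrightarrow> D \<subseteq> {N k..} \<Longrightarrow> (\<forall>n\<in>D. b n \<noteq> 0) \<Longrightarrow>
      norm (max_greedy b e D a) \<le> (1/2)^k"
    by metis
  define p where "p = rec_nat (N 0) (\<lambda>k m. max (Suc m) (N (Suc k)))"
  have p0: "p 0 = N 0" and pS: "p (Suc k) = max (Suc (p k)) (N (Suc k))" for k
    by (simp_all add: p_def)
  have pN: "N k \<le> p k" for k by (cases k) (simp_all add: p0 pS)
  have p: "strict_mono p" by (simp add: strict_mono_Suc_iff pS less_max_iff_disj)
  \<comment> \<open>Indices with \<open>b n = 0\<close> are dropped because the norm bound covers
    only sets without zeros of \<open>b\<close>; by \<open>zero\<close> they do not contribute to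
    the sums.\<close>
  define D where "D k = {n\<in>{p k..<p (Suc k)}. b n \<noteq> 0}" for k
  have finD: "finite (D k)" for k by (simp add: D_def)
  define V where "V k = max_greedy b e (D k) a" for k
  have V0: "0 \<le> V k" for k unfolding V_def by (rule max_greedy_nonneg[OF finD])
  have normV: "norm (V k) \<le> (1/2)^k" for k
    unfolding V_def using pN[of k] by (intro N finD) (auto simp: D_def)
  have V: "summable V"
  proof (rule summable_comparison_test')
    show "summable (\<lambda>k. (1/2::real)^k)" by (rule summable_geometric) simp
  qed (rule normV)
  define u0 where "u0 = (\<Sum>n<p 0. \<bar>a n *\<^sub>R e n\<bar>)"
  have "\<bar>\<Sum>n\<in>A. a n *\<^sub>R e n\<bar> \<le> u0 + suminf V" if A: "A \<in> greedy_sets b UNIV" "finite A" for A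
  proof -
    have step: "\<bar>\<Sum>n\<in>A \<inter> {..<p K}. a n *\<^sub>R e n\<bar> \<le> u0 + (\<Sum>k<K. V k)" for K
    proof (induction K)
      case 0
      have "\<bar>\<Sum>n\<in>A \<inter> {..<p 0}. a n *\<^sub>R e n\<bar> \<le> (\<Sum>n\<in>A \<inter> {..<p 0}. \<bar>a n *\<^sub>R e n\<bar>)"
        by (rule sum_abs)
      also have "\<dots> \<le> u0" unfolding u0_def by (intro sum_mono2) auto
      finally show ?case by simp
    next
      case (Suc K)
      let ?L = "A \<inter> {..<p K}" and ?R = "A \<inter> {p K..<p (Suc K)}"
      have "A \<inter> {..<p (Suc K)} = ?L \<union> ?R" using pS[of K] by auto
      then have "(\<Sum>n\<in>A \<inter> {..<p (Suc K)}. a n *\<^sub>R e n) = (\<Sum>n\<in>?L. a n *\<^sub>R e n) + (\<Sum>n\<in>?R. a n *\<^sub>R e n)"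
        using A(2) by (simp add: sum.union_disjoint disjoint_iff)
      also have "(\<Sum>n\<in>?R. a n *\<^sub>R e n) = (\<Sum>n\<in>A \<inter> D K. a n *\<^sub>R e n)"
        using A(2) zero by (intro sum.mono_neutral_right) (auto simp: D_def)
      finally have "\<bar>\<Sum>n\<in>A \<inter> {..<p (Suc K)}. a n *\<^sub>R e n\<bar>
          \<le> \<bar>\<Sum>n\<in>?L. a n *\<^sub>R e n\<bar> + \<bar>\<Sum>n\<in>A \<inter> D K. a n *\<^sub>R e n\<bar>"
        by (simp add: abs_triangle_ineq)
      also have "\<dots> \<le> (u0 + (\<Sum>k<K. V k)) + V K"
        unfolding V_def
        by (intro add_mono Suc.IH[unfolded V_def] greedy_sum_le_max_greedy greedy_sets_Int finD A(1))
      finally show ?case by (simp add: add.assoc)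
    qed
    obtain K where K: "\<forall>n\<in>A. n < K" using A(2) finite_nat_set_iff_bounded by blast
    have "A \<inter> {..<p K} = A"
      using K strict_mono_imp_increasing[OF p, of K] by auto
    then have "\<bar>\<Sum>n\<in>A. a n *\<^sub>R e n\<bar> \<le> u0 + (\<Sum>k<K. V k)" using step[of K] by simp
    also have "\<dots> \<le> u0 + suminf V" by (intro add_left_mono sum_le_suminf_lattice V V0)
    finally show ?thesis .
  qed
  then show ?thesis by blast
qed

subsection \<open>Scaled bases\<close>

lemma schauder_basis_of_scaled:
  assumes "schauder_basis_of E e" "subspace E" "\<And>n. l n \<noteq> 0"
  shows "schauder_basis_of E (\<lambda>n. l n *\<^sub>R e n)"
  unfolding schauder_basis_of_def
proof (intro conjI ballI)
  show "range (\<lambda>n. l n *\<^sub>R e n) \<subseteq> E"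
    using assms(1,2) by (auto simp: schauder_basis_of_def subspace_scale)
  fix x assume x: "x \<in> E"
  show "\<exists>!a. (\<lambda>n. a n *\<^sub>R l n *\<^sub>R e n) sums x"
  proof (rule ex1I)
    show "(\<lambda>n. (coeff_fun e n x / l n) *\<^sub>R l n *\<^sub>R e n) sums x"
      using coeff_fun_sums[OF assms(1) x] assms(3) by simp
  next
    fix a assume "(\<lambda>n. a n *\<^sub>R l n *\<^sub>R e n) sums x"
    then have "(\<lambda>n. (a n * l n) *\<^sub>R e n) sums x" by simp
    from coeff_fun_unique[OF assms(1) x this] show "a = (\<lambda>n. coeff_fun e n x / l n)"
      using assms(3) by auto
  qed
qed

lemma coeff_fun_scaled:
  assumes "schauder_basis_of E e" "subspace E" "\<And>n. l n \<noteq> 0" "x \<in> E"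
  shows "coeff_fun (\<lambda>n. l n *\<^sub>R e n) n x = coeff_fun e n x / l n"
  using coeff_fun_sums[OF assms(1,4)] assms(3)
  by (intro coeff_fun_unique[OF schauder_basis_of_scaled[OF assms(1-3)] assms(4)]) simp

text \<open>The terms of a convergent series tend to 0, and the norms of the basis vectors are
  bounded below by a positive constant.\<close>

lemma coeff_fun_tendsto_0:
  assumes "schauder_basis_of E e" "semi_normalized e" "x \<in> E"
  shows "(\<lambda>n. coeff_fun e n x) \<longlonglongrightarrow> 0"
proof -
  define \<delta> where "\<delta> = (INF n. norm (e n))"
  have \<delta>: "0 < \<delta>" using assms(2) by (simp add: \<delta>_def semi_normalized_def)
  have le: "\<delta> \<le> norm (e n)" for n
    unfolding \<delta>_def by (rule cINF_lower) (auto intro: bdd_belowI[of _ 0])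
  have "(\<lambda>n. coeff_fun e n x *\<^sub>R e n) \<longlonglongrightarrow> 0"
    using coeff_fun_sums[OF assms(1,3)] summable_LIMSEQ_zero sums_summable by blast
  then have lim: "(\<lambda>n. norm (coeff_fun e n x *\<^sub>R e n) / \<delta>) \<longlonglongrightarrow> 0"
    by (intro tendsto_divide_zero tendsto_norm_zero)
  have "norm (coeff_fun e n x) \<le> norm (coeff_fun e n x *\<^sub>R e n) / \<delta>" for n
    using mult_left_mono[OF le[of n], of "\<bar>coeff_fun e n x\<bar>"] \<delta> by (simp add: field_simps)
  then show ?thesis by (intro Lim_null_comparison[OF always_eventually lim] allI)
qed

theorem proposition3p18:
  fixes E :: "'a::banach_lattice set"
    and e :: "nat \<Rightarrow> 'a"
    and l :: "nat \<Rightarrow> real"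
  assumes "subspace E" and "closed E"
    and "schauder_basis_of E e"
    and "semi_normalized e"
    and "unconditional e"
    and "absolutely_quasi_greedy E e"
    and "0 < (INF n. \<bar>l n\<bar>)" and "bdd_above (range (\<lambda>n. \<bar>l n\<bar>))"
  shows "absolutely_quasi_greedy E (\<lambda>n. l n *\<^sub>R e n)"
proof -
  note basis = assms(3)
  define \<delta> where "\<delta> = (INF n. \<bar>l n\<bar>)"
  have \<delta>: "0 < \<delta>" using assms(7) by (simp add: \<delta>_def)
  have low: "\<delta> \<le> \<bar>l n\<bar>" for n
    unfolding \<delta>_def by (rule cINF_lower) (auto intro: bdd_belowI[of _ 0])
  then have l0: "l n \<noteq> 0" for n using \<delta> by (metis abs_zero not_less)
  obtain L where up: "\<And>n. \<bar>l n\<bar> \<le> L" using assms(8) by (auto simp: bdd_above_def)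
  have L: "0 < L" using \<delta> low[of 0] up[of 0] by linarith
  show ?thesis
  proof (rule absolutely_quasi_greedyI)
    show "schauder_basis_of E (\<lambda>n. l n *\<^sub>R e n)"
      by (rule schauder_basis_of_scaled[OF basis assms(1) l0])
    fix x assume x: "x \<in> E"
    let ?a = "\<lambda>n. coeff_fun e n x"
    \<comment> \<open>\<open>b\<close> holds the coefficients for the scaled basis and decides which
      sets are greedy, whereas the summand \<open>b n *\<^sub>R l n *\<^sub>R e n\<close> has weight
      \<open>?a n\<close> on \<open>e n\<close>.\<close>
    define b where "b n = ?a n / l n" for n
    have coeff: "coeff_fun (\<lambda>n. l n *\<^sub>R e n) n x = b n" for n
      unfolding b_def by (rule coeff_fun_scaled[OF basis assms(1) l0 x])
    have a: "?a n = l n * b n" for n using l0[of n] by (simp add: b_def)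
    have tail: "\<exists>N. \<forall>D \<mu>. finite D \<longrightarrow> D \<subseteq> {N..} \<longrightarrow> (\<forall>n\<in>D. \<bar>\<mu> n\<bar> \<le> 1) \<longrightarrow>
        norm (\<Sum>n\<in>D. (\<mu> n * b n) *\<^sub>R e n) \<le> \<epsilon>" if "0 < \<epsilon>" for \<epsilon>
    proof -
      have "0 < \<epsilon> * \<delta>" using that \<delta> by simp
      from unconditional_bounded_multiplier_sums_small[OF assms(1-3,5) x this] obtain N
        where N: "\<And>D \<mu>. finite D \<Longrightarrow> D \<subseteq> {N..} \<Longrightarrow> (\<forall>n\<in>D. \<bar>\<mu> n\<bar> \<le> 1) \<Longrightarrow>
          norm (\<Sum>n\<in>D. (\<mu> n * ?a n) *\<^sub>R e n) \<le> \<epsilon> * \<delta>" by blast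
      have "norm (\<Sum>n\<in>D. (\<mu> n * b n) *\<^sub>R e n) \<le> \<epsilon>"
        if D: "finite D" "D \<subseteq> {N..}" and \<mu>: "\<forall>n\<in>D. \<bar>\<mu> n\<bar> \<le> 1" for D \<mu>
      proof -
        \<comment> \<open>The factor \<open>\<delta> / l n\<close> is at most 1 in modulus and turns
          \<open>?a n\<close> into \<open>\<delta> * b n\<close>, so the tail estimate for
          \<open>?a\<close> at level \<open>\<epsilon> * \<delta>\<close> serves for
          \<open>b\<close>.\<close>
        have "\<bar>\<mu> n * \<delta> / l n\<bar> \<le> 1" if "n \<in> D" for n
        proof -
          have "\<bar>\<mu> n\<bar> * \<delta> \<le> 1 * \<bar>l n\<bar>" using \<mu> that \<delta> low by (intro mult_mono) auto
          then show ?thesis using \<delta> l0[of n] by (simp add: abs_mult field_simps)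
        qed
        then have "norm (\<Sum>n\<in>D. (\<mu> n * \<delta> / l n * ?a n) *\<^sub>R e n) \<le> \<epsilon> * \<delta>" by (intro N D) auto
        also have "(\<Sum>n\<in>D. (\<mu> n * \<delta> / l n * ?a n) *\<^sub>R e n) = \<delta> *\<^sub>R (\<Sum>n\<in>D. (\<mu> n * b n) *\<^sub>R e n)"
          unfolding scaleR_sum_right by (intro sum.cong) (auto simp: b_def)
        finally show ?thesis using \<delta> by (simp add: mult.commute)
      qed
      then show ?thesis by blast
    qed
    have b: "b \<longlonglongrightarrow> 0"
    proof (rule Lim_null_comparison)
      have "\<bar>b n\<bar> \<le> \<bar>?a n\<bar> / \<delta>" for n
        unfolding b_def abs_divide using low[of n] \<delta> by (intro divide_left_mono) auto
      then show "\<forall>\<^sub>F n in sequentially. norm (b n) \<le> \<bar>?a n\<bar> / \<delta>" by simp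
      show "(\<lambda>n. \<bar>?a n\<bar> / \<delta>) \<longlonglongrightarrow> 0"
        using coeff_fun_tendsto_0[OF basis assms(4) x]
        by (intro tendsto_divide_zero tendsto_rabs_zero)
    qed
    have small: "\<exists>N. \<forall>D. finite D \<longrightarrow> D \<subseteq> {N..} \<longrightarrow> (\<forall>n\<in>D. b n \<noteq> 0) \<longrightarrow>
        norm (max_greedy b e D ?a) \<le> \<eta>" if "0 < \<eta>" for \<eta>
    proof -
      \<comment> \<open>Dividing by \<open>L\<close> brings the multipliers \<open>l n\<close> into
        [-1, 1].\<close>
      have "0 < \<eta> / L" using that L by simp
      from max_greedy_multipliers_small[OF assms(1-3) coeff_fun_tendsto_0[OF basis assms(4)] assms(6)
          tail b this]
      obtain N where N: "\<And>D \<mu>. finite D \<Longrightarrow> D \<subseteq> {N..} \<Longrightarrow> (\<forall>n\<in>D. b n \<noteq> 0 \<and> \<bar>\<mu> n\<bar> \<le> 1) \<Longrightarrow>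
          norm (max_greedy b e D (\<lambda>n. \<mu> n * b n)) \<le> \<eta> / L" by blast
      have "norm (max_greedy b e D ?a) \<le> \<eta>"
        if D: "finite D" "D \<subseteq> {N..}" "\<forall>n\<in>D. b n \<noteq> 0" for D
      proof -
        have "norm (max_greedy b e D (\<lambda>n. l n / L * b n)) \<le> \<eta> / L"
          using D L up by (intro N) auto
        then have "L * norm (max_greedy b e D (\<lambda>n. l n / L * b n)) \<le> \<eta>"
          using L by (simp add: field_simps)
        \<comment> \<open>With a zero second term, \<open>norm_max_greedy_comb\<close> gives the
          estimate for weights multiplied by \<open>L\<close>.\<close>
        moreover have "norm (max_greedy b e D (\<lambda>n. L * (l n / L * b n) + 0 * 0)) \<le>
            L * norm (max_greedy b e D (\<lambda>n. l n / L * b n)) + 0 * norm (max_greedy b e D (\<lambda>_. 0))"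
          using L by (intro norm_max_greedy_comb D(1)) auto
        moreover have "(\<lambda>n. L * (l n / L * b n) + 0 * 0) = ?a" using L by (auto simp: a)
        ultimately show ?thesis by simp
      qed
      then show ?thesis by blast
    qed
    obtain u where u: "\<And>A. A \<in> greedy_sets b UNIV \<Longrightarrow> finite A \<Longrightarrow> \<bar>\<Sum>n\<in>A. ?a n *\<^sub>R e n\<bar> \<le> u"
      using abs_sum_le_of_block_bounds[of b e ?a, OF small] by (auto simp: a)
    show "\<exists>u. \<forall>A\<in>greedy_sets (\<lambda>n. coeff_fun (\<lambda>n. l n *\<^sub>R e n) n x) UNIV. finite A \<longrightarrow>
        \<bar>\<Sum>n\<in>A. coeff_fun (\<lambda>n. l n *\<^sub>R e n) n x *\<^sub>R l n *\<^sub>R e n\<bar> \<le> u"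
      unfolding coeff using u by (intro exI[of _ u]) (auto simp: a mult.commute)
  qed
qed

end
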